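(* Let $\mathbb K$ be an algebraically closed field of characteristic zero and let $R=\mathbb K[x_1,\dots,x_n]$. Let $A$ be a zero-dimensional (finite-dimensional, commutative) $\mathbb K$-algebra which is isomorphic to a quotient of $R$. Let $\mathcal V_A$ be the locus of ideals $I\subset R$ such that $R/I$ is isomorphic to $A$, viewed as a subset of the Hilbert scheme of $\dim_{\mathbb K}A$ points of $\mathbb A^n=\operatorname{Spec}R$. Then the closure of $\mathcal V_A$ in the Hilbert scheme contains a squat ideal.
   Context: A monomial ideal $I\subseteq R=\mathbb K[x_1,\dots,x_n]$ with $\dim_{\mathbb K}R/I<\infty$ is Borel-fixed if for every $i\ge j$ and every monomial $x_im'\in I$ we have $x_jm'\in I$. A zero-dimensional Borel-fixed ideal $I$ is a squat ideal if for every $i$ and every monomial $x_im'\in I$ we have $(x_1,\dots,x_n)^2m'\subset I$. *)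

theory Defs
  imports
    "Jordan_Normal_Form.VS_Connect"
    "HOL-Library.Poly_Mapping"
    "HOL-Algebra.QuotRing"
    "HOL-Algebra.Ideal_Product"
    "HOL-Analysis.Abstract_Topology"
begin

section \<open>Polynomial rings and quotient algebras\<close>

text \<open>The variables are indexed by a finite linearly ordered type \<open>'n\<close>, monomials are exponent
  vectors \<open>'n \<Rightarrow>\<^sub>0 nat\<close>, and polynomials are finitely supported coefficient functions on monomials,
  with the convolution product of \<^theory>\<open>HOL-Library.Poly_Mapping\<close>.\<close>

type_synonym 'n mon = "'n \<Rightarrow>\<^sub>0 nat"
type_synonym ('n, 'k) mpol = "('n \<Rightarrow>\<^sub>0 nat) \<Rightarrow>\<^sub>0 'k"

definition poly_algebra :: "('k::field, ('n, 'k) mpol) module"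
  where "poly_algebra =
    \<lparr>carrier = UNIV, monoid.mult = (*), one = 1, zero = 0, add = (+),
     smult = (\<lambda>c p. Poly_Mapping.single 0 c * p)\<rparr>"

definition xpow :: "'n mon \<Rightarrow> ('n, 'k::field) mpol"
  where "xpow m = Poly_Mapping.single m 1"

definition var :: "'n \<Rightarrow> ('n, 'k::field) mpol"
  where "var i = xpow (Poly_Mapping.single i 1)"

text \<open>The library quotient ring, with scalar multiplication \<open>c \<odot> (I + p) = I + c \<odot> p\<close>; the union
  removes the choice of the representative \<open>p\<close>.\<close>

definition quot_algebra :: "('k, 'a, 'c) module_scheme \<Rightarrow> 'a set \<Rightarrow> ('k, 'a set) module"
  where "quot_algebra R I =
    ring.extend (R Quot I) (module.fields (\<lambda>c C. \<Union>p\<in>C. I +>\<^bsub>R\<^esub> (c \<odot>\<^bsub>R\<^esub> p)))"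

definition alg_isomorphic ::
    "('k::field, 'a, 'c) module_scheme \<Rightarrow> ('k, 'b, 'd) module_scheme \<Rightarrow> bool"
  where "alg_isomorphic A B \<longleftrightarrow>
    ring_iso A B \<inter> LinearCombinations.module_hom class_ring A B \<noteq> {}"


text \<open>The dimension notions of \<^locale>\<open>vectorspace\<close> are total constants, meaningful only for actual
  vector spaces; the following lemmas show that they apply to the quotients \<open>R/I\<close>.\<close>

lemma carrier_poly_algebra [simp]: "carrier poly_algebra = UNIV"
  by (simp add: poly_algebra_def)

lemma poly_algebra_algebra:
  "Module.algebra (class_ring :: 'k::field ring) (poly_algebra :: ('k, ('n, 'k) mpol) module)"
proof -
  have K: "cring (class_ring :: 'k ring)"
    using class_field field_def domain_def by blast
  have "cring (poly_algebra :: ('k, ('n, 'k) mpol) module)"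
    by (rule cringI, rule abelian_groupI, unfold poly_algebra_def)
      (auto simp: algebra_simps intro!: comm_monoidI exI[where x="- x" for x])
  then show ?thesis
    by (intro algebraI K)
      (auto simp: poly_algebra_def algebra_simps single_add mult_single
        simp flip: mult.assoc)
qed

lemma quot_algebra_algebra:
  assumes A: "Module.algebra R A" and I: "ideal I A"
  shows "Module.algebra R (quot_algebra A I)"
proof -
  interpret A: Module.algebra R A by fact
  interpret I: ideal I A by fact
  have Q: "cring (A Quot I)" by (rule I.quotient_is_cring) unfold_locales
  interpret Q: cring "A Quot I" by (rule Q)
  let ?Q = "quot_algebra A I"
  note defs = quot_algebra_def ring.defs module.defs
  have smult_I: "c \<odot>\<^bsub>A\<^esub> x \<in> I" if "c \<in> carrier R" "x \<in> I" for c x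
  proof -
    have x: "x \<in> carrier A" using that by (simp add: I.Icarr)
    have "c \<odot>\<^bsub>A\<^esub> x = (c \<odot>\<^bsub>A\<^esub> \<one>\<^bsub>A\<^esub>) \<otimes>\<^bsub>A\<^esub> x"
      using that x by (simp add: A.smult_assoc2)
    then show ?thesis using that by (simp add: I.I_l_closed)
  qed
  have smult: "c \<odot>\<^bsub>?Q\<^esub> (I +>\<^bsub>A\<^esub> x) = I +>\<^bsub>A\<^esub> (c \<odot>\<^bsub>A\<^esub> x)"
    if c: "c \<in> carrier R" and x: "x \<in> carrier A" for c x
  proof -
    have eq: "I +>\<^bsub>A\<^esub> (c \<odot>\<^bsub>A\<^esub> y) = I +>\<^bsub>A\<^esub> (c \<odot>\<^bsub>A\<^esub> x)" if yx: "y \<in> I +>\<^bsub>A\<^esub> x" for y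
    proof -
      obtain i where i: "i \<in> I" and y: "y = i \<oplus>\<^bsub>A\<^esub> x"
        using yx by (auto simp: a_r_coset_def')
      have "c \<odot>\<^bsub>A\<^esub> y = c \<odot>\<^bsub>A\<^esub> i \<oplus>\<^bsub>A\<^esub> c \<odot>\<^bsub>A\<^esub> x"
        using i y c x by (simp add: A.smult_r_distr I.Icarr)
      then have "c \<odot>\<^bsub>A\<^esub> y \<in> I +>\<^bsub>A\<^esub> (c \<odot>\<^bsub>A\<^esub> x)"
        using smult_I[OF c i] by (auto simp: a_r_coset_def')
      then show ?thesis
        using I.a_repr_independence'[of _ "c \<odot>\<^bsub>A\<^esub> x"] c x by simp
    qed
    have self: "x \<in> I +>\<^bsub>A\<^esub> x" using x by (rule I.a_rcos_self)
    have "c \<odot>\<^bsub>?Q\<^esub> (I +>\<^bsub>A\<^esub> x) = (\<Union>y\<in>I +>\<^bsub>A\<^esub> x. I +>\<^bsub>A\<^esub> (c \<odot>\<^bsub>A\<^esub> y))"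
      by (simp add: defs)
    also have "\<dots> = I +>\<^bsub>A\<^esub> (c \<odot>\<^bsub>A\<^esub> x)" using eq self by blast
    finally show ?thesis .
  qed
  have [simp]: "carrier ?Q = carrier (A Quot I)" "mult ?Q = mult (A Quot I)"
    "one ?Q = one (A Quot I)" "zero ?Q = zero (A Quot I)" "add ?Q = add (A Quot I)"
    by (simp_all add: defs)
  have ex: "\<exists>x\<in>carrier A. X = I +>\<^bsub>A\<^esub> x" if "X \<in> carrier (A Quot I)" for X
    using that by (auto simp: FactRing_def A_RCOSETS_def')
  have closed: "I +>\<^bsub>A\<^esub> x \<in> carrier (A Quot I)" if "x \<in> carrier A" for x
    using that by (auto simp: FactRing_def A_RCOSETS_def')
  have add: "(I +>\<^bsub>A\<^esub> x) \<oplus>\<^bsub>A Quot I\<^esub> (I +>\<^bsub>A\<^esub> y) = I +>\<^bsub>A\<^esub> (x \<oplus>\<^bsub>A\<^esub> y)"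
    if "x \<in> carrier A" "y \<in> carrier A" for x y
    using that by (simp add: FactRing_def I.a_rcos_sum)
  have mult: "(I +>\<^bsub>A\<^esub> x) \<otimes>\<^bsub>A Quot I\<^esub> (I +>\<^bsub>A\<^esub> y) = I +>\<^bsub>A\<^esub> (x \<otimes>\<^bsub>A\<^esub> y)"
    if "x \<in> carrier A" "y \<in> carrier A" for x y
    using that by (simp add: FactRing_def I.rcoset_mult_add)
  show ?thesis
  proof (rule algebraI)
    show "cring R" by unfold_locales
    show "cring ?Q"
    proof (rule cringI)
      show "abelian_group ?Q"
        by (rule abelian_groupI)
          (use Q.add.m_assoc Q.add.m_comm Q.add.l_inv_ex in auto)
      show "comm_monoid ?Q"
        by (rule comm_monoidI) (use Q.m_assoc Q.m_comm in auto)
    qed (simp add: Q.l_distr)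
  next
    fix c X assume "c \<in> carrier R" "X \<in> carrier ?Q"
    then show "c \<odot>\<^bsub>?Q\<^esub> X \<in> carrier ?Q"
      using ex[of X] by (auto simp: smult closed)
  next
    fix b c X assume "b \<in> carrier R" "c \<in> carrier R" "X \<in> carrier ?Q"
    then show "(b \<oplus>\<^bsub>R\<^esub> c) \<odot>\<^bsub>?Q\<^esub> X = (b \<odot>\<^bsub>?Q\<^esub> X) \<oplus>\<^bsub>?Q\<^esub> (c \<odot>\<^bsub>?Q\<^esub> X)"
      using ex[of X] by (auto simp: smult add A.smult_l_distr)
  next
    fix c X Y assume "c \<in> carrier R" "X \<in> carrier ?Q" "Y \<in> carrier ?Q"
    then show "c \<odot>\<^bsub>?Q\<^esub> (X \<oplus>\<^bsub>?Q\<^esub> Y) = (c \<odot>\<^bsub>?Q\<^esub> X) \<oplus>\<^bsub>?Q\<^esub> (c \<odot>\<^bsub>?Q\<^esub> Y)"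
      using ex[of X] ex[of Y] by (auto simp: smult add A.smult_r_distr)
  next
    fix b c X assume "b \<in> carrier R" "c \<in> carrier R" "X \<in> carrier ?Q"
    then show "(b \<otimes>\<^bsub>R\<^esub> c) \<odot>\<^bsub>?Q\<^esub> X = b \<odot>\<^bsub>?Q\<^esub> (c \<odot>\<^bsub>?Q\<^esub> X)"
      using ex[of X] by (auto simp: smult A.smult_assoc1)
  next
    fix X assume "X \<in> carrier ?Q"
    then show "\<one>\<^bsub>R\<^esub> \<odot>\<^bsub>?Q\<^esub> X = X"
      using ex[of X] by (auto simp: smult)
  next
    fix c X Y assume "c \<in> carrier R" "X \<in> carrier ?Q" "Y \<in> carrier ?Q"
    then show "(c \<odot>\<^bsub>?Q\<^esub> X) \<otimes>\<^bsub>?Q\<^esub> Y = c \<odot>\<^bsub>?Q\<^esub> (X \<otimes>\<^bsub>?Q\<^esub> Y)"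
      using ex[of X] ex[of Y] by (auto simp: smult mult A.smult_assoc2)
  qed
qed

section \<open>The Hilbert scheme of points\<close>

lemma quot_poly_algebra_vectorspace:
  assumes "ideal I (poly_algebra :: ('k::field, ('n, 'k) mpol) module)"
  shows "vectorspace class_ring (quot_algebra poly_algebra I)"
  using quot_algebra_algebra[OF poly_algebra_algebra assms] class_field
  by (simp add: vectorspace_def Module.algebra_def)

text \<open>Over an algebraically closed field, the closed points of the Hilbert scheme of \<open>d\<close> points of
  affine space are the ideals of colength \<open>d\<close>, and the closed points in the closure of a set of
  closed points are those in its closure in this subspace. So we equip the set of ideals of
  colength \<open>d\<close> with the Zariski topology.

  The Hilbert scheme is covered by affine open charts, one for each set \<open>B\<close> of \<open>d\<close> monomials: the
  ideals \<open>I\<close> such that the classes of the elements of \<open>B\<close> form a basis of \<open>R/I\<close>. (For \<open>B\<close> of any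
  other cardinality \<open>chart d B\<close> is empty.) The coordinate ring of this chart is generated by the
  functions \<open>coord B I (m, b)\<close>, the coefficient of \<open>b \<in> B\<close> in the expansion of the monomial \<open>m\<close>
  modulo \<open>I\<close>. A set of ideals is open iff its intersection with each chart is open there, i.e. a
  union of nonvanishing loci of polynomials in the coordinates.\<close>

definition hilbert_points :: "nat \<Rightarrow> ('n, 'k::field) mpol set set"
  where "hilbert_points d = {I. ideal I poly_algebra \<and>
    vectorspace.fin_dim class_ring (quot_algebra poly_algebra I) \<and>
    vectorspace.dim class_ring (quot_algebra poly_algebra I) = d}"

definition residue_class :: "('n, 'k::field) mpol set \<Rightarrow> 'n mon \<Rightarrow> ('n, 'k) mpol set"
  where "residue_class I m = I +>\<^bsub>poly_algebra\<^esub> xpow m"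

definition chart :: "nat \<Rightarrow> 'n mon set \<Rightarrow> ('n, 'k::field) mpol set set"
  where "chart d B = {I \<in> hilbert_points d. inj_on (residue_class I) B \<and>
    vectorspace.basis class_ring (quot_algebra poly_algebra I) (residue_class I ` B)}"

definition coord :: "'n mon set \<Rightarrow> ('n, 'k::field) mpol set \<Rightarrow> 'n mon \<times> 'n mon \<Rightarrow> 'k"
  where "coord B I = (\<lambda>(m, b).
    (THE a. a \<in> B \<rightarrow>\<^sub>E UNIV \<and> residue_class I m =
      (\<Oplus>\<^bsub>quot_algebra poly_algebra I\<^esub>b\<in>B. a b \<odot>\<^bsub>quot_algebra poly_algebra I\<^esub> residue_class I b)) b)"

definition poly_eval :: "('v \<Rightarrow> 'k) \<Rightarrow> ('v, 'k::field) mpol \<Rightarrow> 'k"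
  where "poly_eval x p =
    (\<Sum>m\<in>Poly_Mapping.keys p. Poly_Mapping.lookup p m *
      (\<Prod>v\<in>Poly_Mapping.keys m. x v ^ Poly_Mapping.lookup m v))"

definition hilbert_open :: "nat \<Rightarrow> ('n, 'k::field) mpol set set \<Rightarrow> bool"
  where "hilbert_open d U \<longleftrightarrow> U \<subseteq> hilbert_points d \<and>
    (\<forall>B. \<forall>I\<in>U \<inter> chart d B. \<exists>p. poly_eval (coord B I) p \<noteq> 0 \<and>
      (\<forall>J\<in>chart d B. poly_eval (coord B J) p \<noteq> 0 \<longrightarrow> J \<in> U))"

definition hilbert_scheme :: "nat \<Rightarrow> ('n, 'k::field) mpol set topology"
  where "hilbert_scheme d = topology (hilbert_open d)"

lemma poly_eval_superset:
  assumes "finite S" "Poly_Mapping.keys p \<subseteq> S"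
  shows "poly_eval x p = (\<Sum>m\<in>S. Poly_Mapping.lookup p m *
    (\<Prod>v\<in>Poly_Mapping.keys m. x v ^ Poly_Mapping.lookup m v))"
  unfolding poly_eval_def using assms
  by (intro sum.mono_neutral_left) (auto simp: in_keys_iff)

lemma poly_eval_add: "poly_eval x (p + q) = poly_eval x p + poly_eval x q"
proof -
  let ?S = "Poly_Mapping.keys p \<union> Poly_Mapping.keys q"
  have "Poly_Mapping.keys (p + q) \<subseteq> ?S" by (rule Poly_Mapping.keys_add)
  then show ?thesis
    by (simp add: poly_eval_superset[of ?S] lookup_add distrib_right sum.distrib)
qed

lemma mon_eval_superset:
  assumes "finite S" "Poly_Mapping.keys m \<subseteq> S"
  shows "(\<Prod>v\<in>Poly_Mapping.keys m. x v ^ Poly_Mapping.lookup m v) =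
    (\<Prod>v\<in>S. (x v :: 'k::field) ^ Poly_Mapping.lookup m v)"
  using assms by (intro prod.mono_neutral_left) (auto simp: in_keys_iff)

lemma mon_eval_add:
  "(\<Prod>v\<in>Poly_Mapping.keys (m + m'). (x v :: 'k::field) ^ Poly_Mapping.lookup (m + m') v) =
    (\<Prod>v\<in>Poly_Mapping.keys m. x v ^ Poly_Mapping.lookup m v) *
    (\<Prod>v\<in>Poly_Mapping.keys m'. x v ^ Poly_Mapping.lookup m' v)"
proof -
  let ?S = "Poly_Mapping.keys m \<union> Poly_Mapping.keys m'"
  have S: "Poly_Mapping.keys (m + m') \<subseteq> ?S" by (rule Poly_Mapping.keys_add)
  show ?thesis
    unfolding mon_eval_superset[of ?S "m + m'", OF _ S, simplified]
      mon_eval_superset[of ?S m, simplified] mon_eval_superset[of ?S m', simplified]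
    by (simp add: lookup_add power_add prod.distrib)
qed

lemma poly_eval_single:
  "poly_eval x (Poly_Mapping.single m c) =
    c * (\<Prod>v\<in>Poly_Mapping.keys m. x v ^ Poly_Mapping.lookup m v)"
  by (simp add: poly_eval_def)

lemma poly_eval_0 [simp]: "poly_eval x 0 = 0"
  by (simp add: poly_eval_def)

lemma poly_eval_1 [simp]: "poly_eval x 1 = 1"
  using poly_eval_single[of x 0 1] by simp

lemma poly_mapping_add_single_induct [case_names zero add]:
  fixes p :: "'v \<Rightarrow>\<^sub>0 'k::comm_monoid_add"
  assumes "P 0" "\<And>m c p. P p \<Longrightarrow> P (Poly_Mapping.single m c + p)"
  shows "P p"
proof (induction p rule: update_induct)
  case const
  then show ?case by (rule assms)
next
  case (update p m c)
  then have "Poly_Mapping.update m c p = Poly_Mapping.single m c + p"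
    by (intro poly_mapping_eqI)
      (auto simp: lookup_update lookup_add lookup_single in_keys_iff when_def)
  with update assms show ?case by simp
qed

lemma poly_eval_mult: "poly_eval x (p * q) = poly_eval x p * poly_eval x q"
proof (induction p rule: poly_mapping_add_single_induct)
  case (add m c p)
  have "poly_eval x (Poly_Mapping.single m c * q) =
    poly_eval x (Poly_Mapping.single m c) * poly_eval x q"
    by (induction q rule: poly_mapping_add_single_induct)
      (simp_all add: mult_single poly_eval_single mon_eval_add poly_eval_add distrib_left)
  with add show ?case by (simp add: poly_eval_add distrib_right)
qed simp

lemma istopology_hilbert_open: "istopology (hilbert_open d)"
  unfolding istopology_def
proof (intro conjI allI impI)
  fix U V :: "('n, 'k::field) mpol set set"
  assume U: "hilbert_open d U" and V: "hilbert_open d V"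
  show "hilbert_open d (U \<inter> V)"
    unfolding hilbert_open_def
  proof (intro conjI allI ballI)
    show "U \<inter> V \<subseteq> hilbert_points d" using U by (auto simp: hilbert_open_def)
    fix B I assume I: "I \<in> U \<inter> V \<inter> chart d B"
    obtain p where p: "poly_eval (coord B I) p \<noteq> 0"
      "\<And>J. J \<in> chart d B \<Longrightarrow> poly_eval (coord B J) p \<noteq> 0 \<Longrightarrow> J \<in> U"
      using U I unfolding hilbert_open_def by blast
    obtain q where q: "poly_eval (coord B I) q \<noteq> 0"
      "\<And>J. J \<in> chart d B \<Longrightarrow> poly_eval (coord B J) q \<noteq> 0 \<Longrightarrow> J \<in> V"
      using V I unfolding hilbert_open_def by blast
    show "\<exists>p. poly_eval (coord B I) p \<noteq> 0 \<and>
      (\<forall>J\<in>chart d B. poly_eval (coord B J) p \<noteq> 0 \<longrightarrow> J \<in> U \<inter> V)"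
      using p q by (intro exI[of _ "p * q"]) (auto simp: poly_eval_mult)
  qed
next
  fix \<K> :: "('n, 'k::field) mpol set set set"
  assume K: "\<forall>U\<in>\<K>. hilbert_open d U"
  show "hilbert_open d (\<Union>\<K>)"
    unfolding hilbert_open_def
  proof (intro conjI allI ballI)
    show "\<Union>\<K> \<subseteq> hilbert_points d" using K by (auto simp: hilbert_open_def)
    fix B I assume "I \<in> \<Union>\<K> \<inter> chart d B"
    then obtain U where U: "U \<in> \<K>" "I \<in> U \<inter> chart d B" by auto
    then obtain p where "poly_eval (coord B I) p \<noteq> 0"
      "\<forall>J\<in>chart d B. poly_eval (coord B J) p \<noteq> 0 \<longrightarrow> J \<in> U"
      using K unfolding hilbert_open_def by blast
    then show "\<exists>p. poly_eval (coord B I) p \<noteq> 0 \<and>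
      (\<forall>J\<in>chart d B. poly_eval (coord B J) p \<noteq> 0 \<longrightarrow> J \<in> \<Union>\<K>)"
      using U by blast
  qed
qed

lemma openin_hilbert_scheme: "openin (hilbert_scheme d) U \<longleftrightarrow> hilbert_open d U"
  by (simp add: hilbert_scheme_def istopology_hilbert_open)

lemma topspace_hilbert_scheme: "topspace (hilbert_scheme d) = hilbert_points d"
proof
  show "topspace (hilbert_scheme d) \<subseteq> hilbert_points d"
    using openin_topspace[of "hilbert_scheme d"]
    unfolding openin_hilbert_scheme hilbert_open_def by blast
  have "hilbert_open d (hilbert_points d)"
    by (auto simp: hilbert_open_def chart_def intro!: exI[of _ 1])
  then show "hilbert_points d \<subseteq> topspace (hilbert_scheme d)"
    by (intro openin_subset) (simp add: openin_hilbert_scheme)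
qed

definition iso_locus :: "('k::field, 'a) module \<Rightarrow> ('n, 'k) mpol set set"
  where "iso_locus A = {I. ideal I poly_algebra \<and> alg_isomorphic (quot_algebra poly_algebra I) A}"

section \<open>Squat ideals\<close>

definition monomial_ideal :: "('n, 'k::field) mpol set \<Rightarrow> bool"
  where "monomial_ideal I \<longleftrightarrow> (\<exists>S. I = genideal poly_algebra (xpow ` S))"

definition zero_dim_ideal :: "('n, 'k::field) mpol set \<Rightarrow> bool"
  where "zero_dim_ideal I \<longleftrightarrow> ideal I poly_algebra \<and>
    vectorspace.fin_dim class_ring (quot_algebra poly_algebra I)"

definition borel_fixed :: "('n::linorder, 'k::field) mpol set \<Rightarrow> bool"
  where "borel_fixed I \<longleftrightarrow> monomial_ideal I \<and> zero_dim_ideal I \<and>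
    (\<forall>i j m. j \<le> i \<longrightarrow> var i * xpow m \<in> I \<longrightarrow> var j * xpow m \<in> I)"

definition irrelevant_ideal :: "('n, 'k::field) mpol set"
  where "irrelevant_ideal = genideal poly_algebra (range var)"

text \<open>\<open>q\<close> ranges over the square of the ideal generated by the variables.\<close>

definition squat :: "('n::linorder, 'k::field) mpol set \<Rightarrow> bool"
  where "squat I \<longleftrightarrow> borel_fixed I \<and>
    (\<forall>i m. var i * xpow m \<in> I \<longrightarrow>
      (\<forall>q \<in> ideal_prod poly_algebra irrelevant_ideal irrelevant_ideal. q * xpow m \<in> I))"

end

theory Submission
  imports Defs
begin

text \<open>Let \<open>J\<close> be an ideal of the polynomial ring \<open>R\<close> with \<open>R/J \<cong> A\<close>. For a tuple \<open>f\<close> of \<open>n\<close> polynomials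
  let \<open>m(f)\<close> be the value of the monomial \<open>m\<close> at \<open>f\<close>. If the classes of \<open>b(f)\<close> for \<open>b\<close> in a set \<open>B\<close> of
  monomials form a basis of \<open>R/J\<close>, then \<open>f\<close> generates \<open>R/J\<close> as an algebra, so the ideal of all \<open>p\<close> with
  \<open>p(f) \<in> J\<close> belongs to the locus of \<open>A\<close>, and \<open>B\<close> is a basis of its quotient. Choose positive weights
  of the variables such that earlier variables are heavier, a product of two variables is heavier than
  any variable, and monomials of bounded degree are distinguished by their weights
  (\<open>separating_weights\<close>). Among all pairs of such \<open>B\<close> of bounded degree and \<open>f\<close>, choose one for which
  the total weight of \<open>B\<close> is minimal. Then the monomials outside \<open>B\<close> span the desired ideal.

  This span is an ideal in the closure. By the exchange property and minimality, a monomial outside \<open>B\<close>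
  is, at \<open>f\<close> and modulo \<open>J\<close>, a combination of strictly lighter elements of \<open>B\<close>
  (\<open>coef_nonzero_imp_wt_less\<close>). It follows that the complement of \<open>B\<close> is closed under multiplication
  (\<open>complement_closed\<close>). When each \<open>f\<^sub>i\<close> is multiplied by the power of \<open>t\<close> given by its weight, the
  coefficients of these combinations are multiplied by positive powers of \<open>t\<close>. So the ideals in the
  locus of \<open>A\<close> obtained in this way tend to the monomial ideal as \<open>t\<close> tends to 0
  (\<open>complement_in_closure\<close>).

  The ideal is squat. For monomial ideals in characteristic zero, being Borel-fixed and squat amounts to
  invariance under the derivations \<open>q \<partial>/\<partial>x\<^sub>i\<close>, where \<open>q\<close> is an earlier variable or a product of two
  variables; in both cases \<open>q\<close> is heavier than \<open>x\<^sub>i\<close>. A fixed point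
  of a solvable group in the closure would have this property, but the minimal choice yields it
  directly. Suppose that \<open>m x\<^sub>i\<close> is outside \<open>B\<close> and \<open>m q\<close> is in \<open>B\<close>. If \<open>f\<^sub>i\<close> is moved to
  \<open>f\<^sub>i + t q(f)\<close>, then to first order in \<open>t\<close> the value of \<open>m x\<^sub>i\<close> acquires a nonzero multiple of
  \<open>(m q)(f)\<close>, the factor being the exponent of \<open>x\<^sub>i\<close> in \<open>m x\<^sub>i\<close>. So for some \<open>t\<close> the set \<open>B\<close> with
  \<open>m q\<close> replaced by the lighter \<open>m x\<^sub>i\<close> still gives a basis, which contradicts minimality
  (\<open>complement_sheared\<close>).\<close>

section \<open>Bases of quotients of the polynomial ring\<close>

definition cst :: "'k::field \<Rightarrow> ('n, 'k) mpol"
  where "cst c = Poly_Mapping.single 0 c"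

lemma cst_0 [simp]: "cst 0 = 0" and cst_1 [simp]: "cst 1 = 1"
  by (simp_all add: cst_def)

lemma cst_add: "cst (a + b) = cst a + cst b"
  by (simp add: cst_def single_add)

lemma cst_mult: "cst (a * b) = cst a * cst b"
  by (simp add: cst_def mult_single)

lemma cst_uminus: "cst (- a) = - cst a"
  using cst_add[of a "- a"] by (simp add: eq_neg_iff_add_eq_0 add.commute)

lemma cst_diff: "cst (a - b) = cst a - cst b"
  by (simp add: cst_def single_diff)

lemma cst_power: "cst (a ^ n) = cst a ^ n"
  by (induction n) (simp_all add: cst_mult)

locale poly_ideal =
  fixes J :: "('n, 'k::field) mpol set"
  assumes zero_mem [simp]: "0 \<in> J"
    and add_mem: "p \<in> J \<Longrightarrow> q \<in> J \<Longrightarrow> p + q \<in> J"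
    and mult_mem: "p \<in> J \<Longrightarrow> r * p \<in> J"
begin

lemma uminus_mem: "p \<in> J \<Longrightarrow> - p \<in> J"
  using mult_mem[of p "- 1"] by simp

lemma diff_mem: "p \<in> J \<Longrightarrow> q \<in> J \<Longrightarrow> p - q \<in> J"
  using add_mem[of p "- q"] uminus_mem[of q] by simp

lemma diff_mem_swap: "p - q \<in> J \<Longrightarrow> q - p \<in> J"
  using uminus_mem[of "p - q"] by simp

lemma diff_mem_trans: "p - q \<in> J \<Longrightarrow> q - r \<in> J \<Longrightarrow> p - r \<in> J"
  using add_mem[of "p - q" "q - r"] by simp

lemma sum_mem: "(\<And>x. x \<in> S \<Longrightarrow> f x \<in> J) \<Longrightarrow> sum f S \<in> J"
  by (induction S rule: infinite_finite_induct) (auto intro: add_mem)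

lemma mult_diff_mem: "p - q \<in> J \<Longrightarrow> r * p - r * q \<in> J"
  using mult_mem[of "p - q" r] by (simp add: algebra_simps)

end

text \<open>A basis of \<open>R/J\<close> is given by a family of representatives \<open>g\<close> over an index set \<open>B\<close>, so that the same
index set of monomials can be evaluated at varying tuples of polynomials.\<close>

definition basis_mod :: "('n, 'k::field) mpol set \<Rightarrow> 'i set \<Rightarrow> ('i \<Rightarrow> ('n, 'k) mpol) \<Rightarrow> bool"
  where "basis_mod J B g \<longleftrightarrow> finite B \<and>
    (\<forall>r. \<exists>c. r - (\<Sum>b\<in>B. cst (c b) * g b) \<in> J) \<and>
    (\<forall>c. (\<Sum>b\<in>B. cst (c b) * g b) \<in> J \<longrightarrow> (\<forall>b\<in>B. c b = 0))"

lemma basis_modD: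
  assumes "basis_mod J B g"
  shows "finite B"
    and "\<exists>c. r - (\<Sum>b\<in>B. cst (c b) * g b) \<in> J"
    and "(\<Sum>b\<in>B. cst (c b) * g b) \<in> J \<Longrightarrow> b \<in> B \<Longrightarrow> c b = 0"
  using assms unfolding basis_mod_def by simp_all

definition coeff_mod :: "('n, 'k::field) mpol set \<Rightarrow> 'i set \<Rightarrow> ('i \<Rightarrow> ('n, 'k) mpol) \<Rightarrow>
    ('n, 'k) mpol \<Rightarrow> 'i \<Rightarrow> 'k"
  where "coeff_mod J B g r = (SOME c. r - (\<Sum>b\<in>B. cst (c b) * g b) \<in> J)"

context poly_ideal
begin

lemma coeff_mod:
  "basis_mod J B g \<Longrightarrow> r - (\<Sum>b\<in>B. cst (coeff_mod J B g r b) * g b) \<in> J"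
  unfolding coeff_mod_def by (rule someI_ex[OF basis_modD(2)])

lemma basis_mod_eq:
  assumes "basis_mod J B g" "(\<Sum>b\<in>B. cst (c b) * g b) - (\<Sum>b\<in>B. cst (c' b) * g b) \<in> J" "b \<in> B"
  shows "c b = c' b"
proof -
  have "(\<Sum>b\<in>B. cst (c b - c' b) * g b) \<in> J"
    using assms(2) by (simp add: cst_diff left_diff_distrib sum_subtractf)
  from basis_modD(3)[OF assms(1) this assms(3)] show ?thesis by simp
qed

lemma coeff_mod_unique:
  assumes "basis_mod J B g" "r - (\<Sum>b\<in>B. cst (c b) * g b) \<in> J" "b \<in> B"
  shows "coeff_mod J B g r b = c b"
  using basis_mod_eq[OF assms(1) _ assms(3)]
    diff_mem_trans[OF diff_mem_swap[OF coeff_mod[OF assms(1)]] assms(2)] by blast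

lemma coeff_mod_cong:
  assumes "basis_mod J B g" "r - s \<in> J" "b \<in> B"
  shows "coeff_mod J B g r b = coeff_mod J B g s b"
  using coeff_mod_unique[OF assms(1) diff_mem_trans[OF assms(2) coeff_mod[OF assms(1)]] assms(3)] .

lemma coeff_mod_add:
  assumes "basis_mod J B g" "b \<in> B"
  shows "coeff_mod J B g (r + s) b = coeff_mod J B g r b + coeff_mod J B g s b"
proof (rule coeff_mod_unique[OF assms(1) _ assms(2)])
  show "r + s - (\<Sum>b\<in>B. cst (coeff_mod J B g r b + coeff_mod J B g s b) * g b) \<in> J"
    using add_mem[OF coeff_mod[OF assms(1), of r] coeff_mod[OF assms(1), of s]]
    by (simp add: cst_add distrib_right sum.distrib algebra_simps)
qed

lemma coeff_mod_scale:
  assumes "basis_mod J B g" "b \<in> B"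
  shows "coeff_mod J B g (cst a * r) b = a * coeff_mod J B g r b"
proof (rule coeff_mod_unique[OF assms(1) _ assms(2)])
  show "cst a * r - (\<Sum>b\<in>B. cst (a * coeff_mod J B g r b) * g b) \<in> J"
    using mult_mem[OF coeff_mod[OF assms(1), of r], of "cst a"]
    by (simp add: cst_mult right_diff_distrib sum_distrib_left mult.assoc)
qed

lemma coeff_mod_zero:
  "basis_mod J B g \<Longrightarrow> r \<in> J \<Longrightarrow> b \<in> B \<Longrightarrow> coeff_mod J B g r b = 0"
  by (rule coeff_mod_unique) auto

lemma coeff_mod_diff:
  assumes "basis_mod J B g" "b \<in> B"
  shows "coeff_mod J B g (r - s) b = coeff_mod J B g r b - coeff_mod J B g s b"
  using coeff_mod_add[OF assms, of "r - s" s] by simp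

lemma coeff_mod_sum:
  assumes "basis_mod J B g" "b \<in> B"
  shows "coeff_mod J B g (sum f S) b = (\<Sum>x\<in>S. coeff_mod J B g (f x) b)"
proof (induction S rule: infinite_finite_induct)
qed (simp_all add: coeff_mod_zero[OF assms(1) zero_mem assms(2)] coeff_mod_add[OF assms])

lemma coeff_mod_basis:
  assumes "basis_mod J B g" "b \<in> B" "b' \<in> B"
  shows "coeff_mod J B g (g b) b' = (if b' = b then 1 else 0)"
proof (rule coeff_mod_unique[OF assms(1) _ assms(3)])
  have fin: "finite B" using assms by (simp add: basis_mod_def)
  have "(\<Sum>b'\<in>B. cst (if b' = b then 1 else 0) * g b') = (\<Sum>b'\<in>B. if b' = b then g b' else 0)"
    by (rule sum.cong) auto
  also have "\<dots> = g b" using fin assms(2) by (simp add: sum.delta)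
  finally show "g b - (\<Sum>b'\<in>B. cst (if b' = b then 1 else 0) * g b') \<in> J" by simp
qed

text \<open>A family is a basis when the matrix of its coordinates with respect to a known basis has a
two-sided inverse \<open>N\<close>: one side gives generation, the other gives independence.\<close>

lemma basis_mod_matrix:
  assumes B: "basis_mod J B g"
    and inv: "\<And>b b'. b \<in> B \<Longrightarrow> b' \<in> B \<Longrightarrow>
        (\<Sum>x\<in>B. N b x * coeff_mod J B g (h x) b') = (if b' = b then 1 else 0)"
      "\<And>b b'. b \<in> B \<Longrightarrow> b' \<in> B \<Longrightarrow>
        (\<Sum>x\<in>B. coeff_mod J B g (h b) x * N x b') = (if b' = b then 1 else 0)"
  shows "basis_mod J B h"
  unfolding basis_mod_def
proof (intro conjI allI impI ballI)
  show fin: "finite B" using B by (simp add: basis_mod_def)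
  fix r
  let ?l = "coeff_mod J B g"
  have coeff_lincomb: "?l (\<Sum>b\<in>B. cst (c b) * h b) b' = (\<Sum>b\<in>B. c b * ?l (h b) b')"
    if "b' \<in> B" for c b'
    using that by (simp add: coeff_mod_sum[OF B] coeff_mod_scale[OF B])
  have zeroI: "p \<in> J" if "\<And>b. b \<in> B \<Longrightarrow> ?l p b = 0" for p
    using coeff_mod[OF B, of p] that by simp
  show "\<exists>c. r - (\<Sum>b\<in>B. cst (c b) * h b) \<in> J"
  proof (intro exI zeroI)
    fix b' assume b': "b' \<in> B"
    have "(\<Sum>b\<in>B. (\<Sum>x\<in>B. ?l r x * N x b) * ?l (h b) b') =
        (\<Sum>b\<in>B. \<Sum>x\<in>B. ?l r x * (N x b * ?l (h b) b'))"
      by (simp add: sum_distrib_right mult.assoc)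
    also have "\<dots> = (\<Sum>x\<in>B. \<Sum>b\<in>B. ?l r x * (N x b * ?l (h b) b'))"
      by (rule sum.swap)
    also have "\<dots> = (\<Sum>x\<in>B. ?l r x * (if b' = x then 1 else 0))"
      using b' by (simp add: inv flip: sum_distrib_left)
    also have "\<dots> = (\<Sum>x\<in>B. if b' = x then ?l r x else 0)"
      by (rule sum.cong) auto
    also have "\<dots> = ?l r b'" using fin b' by simp
    finally show "?l (r - (\<Sum>b\<in>B. cst (\<Sum>x\<in>B. ?l r x * N x b) * h b)) b' = 0"
      by (simp add: coeff_mod_diff[OF B b'] coeff_lincomb[OF b'])
  qed
next
  fix c b assume c: "(\<Sum>b\<in>B. cst (c b) * h b) \<in> J" and b: "b \<in> B"
  have fin: "finite B" using B by (simp add: basis_mod_def)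
  let ?l = "coeff_mod J B g"
  have 0: "(\<Sum>y\<in>B. c y * ?l (h y) x) = 0" if "x \<in> B" for x
    using coeff_mod_zero[OF B c that] that
    by (simp add: coeff_mod_sum[OF B] coeff_mod_scale[OF B])
  have "c b = (\<Sum>y\<in>B. if b = y then c y else 0)"
    using fin b by simp
  also have "\<dots> = (\<Sum>y\<in>B. c y * (\<Sum>x\<in>B. ?l (h y) x * N x b))"
    using b by (intro sum.cong) (auto simp: inv)
  also have "\<dots> = (\<Sum>y\<in>B. \<Sum>x\<in>B. c y * ?l (h y) x * N x b)"
    by (simp add: sum_distrib_left mult.assoc)
  also have "\<dots> = (\<Sum>x\<in>B. \<Sum>y\<in>B. c y * ?l (h y) x * N x b)"
    by (rule sum.swap)
  also have "\<dots> = (\<Sum>x\<in>B. (\<Sum>y\<in>B. c y * ?l (h y) x) * N x b)"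
    by (simp add: sum_distrib_right)
  also have "\<dots> = 0" using 0 by simp
  finally show "c b = 0" .
qed

text \<open>The exchange step of Steinitz. The case \<open>m = b0\<close>, in which only the representative of one basis
element changes, is included.\<close>

lemma basis_mod_exchange:
  assumes B: "basis_mod J B g" and b0: "b0 \<in> B" and m: "m \<notin> B - {b0}"
    and eq: "\<And>b. b \<in> B - {b0} \<Longrightarrow> g' b = g b"
    and nz: "coeff_mod J B g (g' m) b0 \<noteq> 0"
  shows "basis_mod J (insert m (B - {b0})) g'"
proof -
  let ?C = "B - {b0}" and ?l = "coeff_mod J B g"
  have fin: "finite B" using B by (simp add: basis_mod_def)
  have split: "(\<Sum>b\<in>insert m ?C. cst (c b) * g' b) = cst (c m) * g' m + (\<Sum>b\<in>?C. cst (c b) * g b)" for c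
    using fin m by (simp add: eq)
  have splitB: "(\<Sum>b\<in>B. cst (c b) * g b) = cst (c b0) * g b0 + (\<Sum>b\<in>?C. cst (c b) * g b)" for c
    using fin b0 by (simp add: sum.remove)
  show ?thesis unfolding basis_mod_def
  proof (intro conjI allI impI)
    show "finite (insert m ?C)" using fin by simp
    fix r
    define a where "a = ?l r b0 / ?l (g' m) b0"
    define c where "c = (\<lambda>b. if b = m then a else ?l r b - a * ?l (g' m) b)"
    have "r - (\<Sum>b\<in>insert m ?C. cst (c b) * g' b) =
      (r - (\<Sum>b\<in>B. cst (?l r b) * g b)) - cst a * (g' m - (\<Sum>b\<in>B. cst (?l (g' m) b) * g b))"
    proof -
      have 1: "(\<Sum>b\<in>?C. cst (c b) * g b) = (\<Sum>b\<in>?C. cst (?l r b - a * ?l (g' m) b) * g b)"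
        using m by (intro sum.cong) (auto simp: c_def)
      have 2: "cst (?l r b0) = cst a * cst (?l (g' m) b0)"
        using nz by (simp add: a_def flip: cst_mult)
      show ?thesis unfolding split splitB 1 2
        by (simp add: c_def cst_diff cst_mult algebra_simps sum_subtractf sum_distrib_left)
    qed
    also have "\<dots> \<in> J"
      by (intro diff_mem mult_mem coeff_mod[OF B])
    finally show "\<exists>c. r - (\<Sum>b\<in>insert m ?C. cst (c b) * g' b) \<in> J"
      by (rule exI[where x = c])
  next
    fix c assume c: "(\<Sum>b\<in>insert m ?C. cst (c b) * g' b) \<in> J"
    have l: "0 = c m * ?l (g' m) b + (if b = b0 then 0 else c b)" if "b \<in> B" for b
    proof -
      have "(\<Sum>b\<in>?C. cst (c b) * g b) = (\<Sum>b\<in>B. cst (if b = b0 then 0 else c b) * g b)"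
        unfolding splitB by simp
      then have "?l (\<Sum>b\<in>?C. cst (c b) * g b) b = (if b = b0 then 0 else c b)"
        using that coeff_mod_unique[OF B, of "\<Sum>b\<in>?C. cst (c b) * g b"
            "\<lambda>b. if b = b0 then 0 else c b" b] by simp
      then show ?thesis
        using coeff_mod_zero[OF B c that] that unfolding split
        by (simp add: coeff_mod_add[OF B] coeff_mod_scale[OF B])
    qed
    have "c m = 0" using l[OF b0] nz by simp
    show "\<forall>b\<in>insert m ?C. c b = 0"
    proof
      fix b assume "b \<in> insert m ?C"
      then show "c b = 0" using l[of b] \<open>c m = 0\<close> by (cases "b = m") auto
    qed
  qed
qed

end

lemma poly_comm_ring_hom: "comm_ring_hom (\<lambda>p :: 'k::comm_ring_1 poly. poly p a)"
  by unfold_locales auto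

text \<open>The determinant is a polynomial in \<open>t\<close> with value 1 at \<open>t = 0\<close>, so it has only finitely many zeros,
whereas the field is infinite.\<close>

lemma polynomial_matrix_invertible_nearby:
  fixes P :: "'i \<Rightarrow> 'i \<Rightarrow> 'k::field_char_0 poly"
  assumes fin: "finite B"
    and P0: "\<And>b b'. b \<in> B \<Longrightarrow> b' \<in> B \<Longrightarrow> poly (P b b') 0 = (if b' = b then 1 else 0)"
  obtains t N where "t \<noteq> 0"
    "\<And>b b'. b \<in> B \<Longrightarrow> b' \<in> B \<Longrightarrow>
      (\<Sum>x\<in>B. N b x * poly (P x b') t) = (if b' = b then 1 else 0)"
    "\<And>b b'. b \<in> B \<Longrightarrow> b' \<in> B \<Longrightarrow>
      (\<Sum>x\<in>B. poly (P b x) t * N x b') = (if b' = b then 1 else 0)"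
proof -
  define n where "n = card B"
  obtain e where e: "bij_betw e {0..<n} B"
    using fin ex_bij_betw_nat_finite unfolding n_def by blast
  define M where "M = mat n n (\<lambda>(i, j). P (e i) (e j))"
  have M: "M \<in> carrier_mat n n" by (simp add: M_def)
  have mem: "e i \<in> B" if "i < n" for i using e that by (auto simp: bij_betw_def)
  have inj: "e i = e j \<longleftrightarrow> i = j" if "i < n" "j < n" for i j
    using e that by (auto simp: bij_betw_def inj_on_def)
  have "map_mat (\<lambda>p. poly p 0) M = 1\<^sub>m n"
    by (rule eq_matI) (auto simp: M_def P0 mem inj)
  then have "poly (det M) 0 = 1"
    using comm_ring_hom.hom_det[OF poly_comm_ring_hom, of 0 M] by simp
  \<comment> \<open>the factor \<open>t\<close> makes the chosen non-root different from 0\<close>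
  then have "det M * [:0, 1:] \<noteq> 0" by auto
  then have "finite {t. poly (det M * [:0, 1:]) t = 0}" by (rule poly_roots_finite)
  then obtain t where t: "poly (det M * [:0, 1:]) t \<noteq> 0"
    using infinite_UNIV_char_0[where 'a = 'k] ex_new_if_finite by blast
  define A where "A = map_mat (\<lambda>p. poly p t) M"
  have A: "A \<in> carrier_mat n n" using M by (simp add: A_def)
  have det: "det A \<noteq> 0" using t comm_ring_hom.hom_det[OF poly_comm_ring_hom, of t M] by (simp add: A_def)
  define D where "D = (1 / det A) \<cdot>\<^sub>m adj_mat A"
  have D: "D \<in> carrier_mat n n" using adj_mat(1)[OF A] by (simp add: D_def)
  have AD: "A * D = 1\<^sub>m n" "D * A = 1\<^sub>m n"
    using adj_mat[OF A] A det
    by (auto simp: D_def mult_smult_distrib[of _ n n] mult_smult_assoc_mat[of _ n n] intro!: eq_matI)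
  define e' where "e' = the_inv_into {0..<n} e"
  have e': "e' b < n" "e (e' b) = b" if "b \<in> B" for b
    using that e the_inv_into_into[of e "{0..<n}" b "{0..<n}"] f_the_inv_into_f[of e "{0..<n}" b]
    unfolding e'_def bij_betw_def by auto
  have e'e: "e' (e i) = i" if "i < n" for i
    using e that by (auto simp: e'_def bij_betw_def the_inv_into_f_f)
  have sumB: "(\<Sum>x\<in>B. F x) = (\<Sum>i = 0..<n. F (e i))" for F :: "'i \<Rightarrow> 'k"
    using sum.reindex_bij_betw[OF e, of F] by simp
  have Ae: "poly (P b b') t = A $$ (e' b, e' b')" if "b \<in> B" "b' \<in> B" for b b'
    using that e' by (simp add: A_def M_def)
  have prod: "(\<Sum>x\<in>B. X $$ (e' b, e' x) * Y $$ (e' x, e' b')) = (if b' = b then 1 else 0)"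
    if "X * Y = 1\<^sub>m n" "X \<in> carrier_mat n n" "Y \<in> carrier_mat n n" "b \<in> B" "b' \<in> B"
    for X Y :: "'k mat" and b b'
  proof -
    have "(\<Sum>x\<in>B. X $$ (e' b, e' x) * Y $$ (e' x, e' b')) = (X * Y) $$ (e' b, e' b')"
      using that(2,3) e'(1)[OF that(4)] e'(1)[OF that(5)]
      unfolding sumB by (simp add: e'e scalar_prod_def)
    also have "\<dots> = (if b' = b then 1 else 0)"
      unfolding that(1) using e'(1)[OF that(4)] e'(1)[OF that(5)] e'(2)[OF that(4)] e'(2)[OF that(5)]
      by (cases "b' = b") auto
    finally show ?thesis .
  qed
  show ?thesis
  proof (rule that)
    show "t \<noteq> 0" using t by auto
    show "(\<Sum>x\<in>B. D $$ (e' b, e' x) * poly (P x b') t) = (if b' = b then 1 else 0)"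
      if "b \<in> B" "b' \<in> B" for b b'
      using prod[OF AD(2) D A that] that by (simp add: Ae)
    show "(\<Sum>x\<in>B. poly (P b x) t * D $$ (e' x, e' b')) = (if b' = b then 1 else 0)"
      if "b \<in> B" "b' \<in> B" for b b'
      using prod[OF AD(1) A D that] that by (simp add: Ae)
  qed
qed

lemma poly_functional:
  fixes G :: "('n, 'k::field) mpol poly" and l :: "('n, 'k) mpol \<Rightarrow> 'k"
  assumes add: "\<And>p q. l (p + q) = l p + l q" and scale: "\<And>c p. l (cst c * p) = c * l p"
  shows "l (poly G (cst t)) = poly (map_poly l G) t"
proof -
  have 0: "l 0 = 0" using scale[of 0 0] by simp
  show ?thesis
    by (induction G) (simp_all add: 0 map_poly_pCons add scale)
qed

text \<open>Being a basis is an open condition: a family of polynomial curves that is a basis at \<open>t = 0\<close> is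
a basis at some \<open>t \<noteq> 0\<close>.\<close>

lemma basis_mod_nearby:
  fixes G :: "'i \<Rightarrow> ('n, 'k::field_char_0) mpol poly"
  assumes "poly_ideal J"
  assumes B: "basis_mod J B (\<lambda>b. poly (G b) 0)"
  obtains t where "t \<noteq> 0" "basis_mod J B (\<lambda>b. poly (G b) (cst t))"
proof -
  interpret poly_ideal J by fact
  let ?l = "coeff_mod J B (\<lambda>b. poly (G b) 0)"
  have fin: "finite B" using B by (simp add: basis_mod_def)
  define P where "P b b' = map_poly (\<lambda>r. ?l r b') (G b)" for b b'
  have P: "poly (P b b') t = ?l (poly (G b) (cst t)) b'" if "b' \<in> B" for b b' t
    unfolding P_def
    by (rule poly_functional[symmetric])
      (simp_all add: coeff_mod_add[OF B that] coeff_mod_scale[OF B that])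
  have "poly (P b b') 0 = (if b' = b then 1 else 0)" if "b \<in> B" "b' \<in> B" for b b'
    using coeff_mod_basis[OF B that] that by (simp add: P)
  from polynomial_matrix_invertible_nearby[OF fin this] obtain t N where t: "t \<noteq> 0"
    and N: "\<And>b b'. b \<in> B \<Longrightarrow> b' \<in> B \<Longrightarrow>
      (\<Sum>x\<in>B. N b x * poly (P x b') t) = (if b' = b then 1 else 0)"
    "\<And>b b'. b \<in> B \<Longrightarrow> b' \<in> B \<Longrightarrow>
      (\<Sum>x\<in>B. poly (P b x) t * N x b') = (if b' = b then 1 else 0)" by blast
  from N have "basis_mod J B (\<lambda>b. poly (G b) (cst t))"
    by (intro basis_mod_matrix[OF B, of N]) (simp_all add: P)
  with t that show ?thesis by blast
qed

section \<open>Substitution of polynomials into monomials and polynomials\<close>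

text \<open>The values live in an arbitrary semiring: below, tuples of polynomials are substituted, and also
tuples of polynomials in one further indeterminate, which describe curves of tuples.\<close>

definition mev :: "('n::finite \<Rightarrow> 'r::comm_semiring_1) \<Rightarrow> 'n mon \<Rightarrow> 'r"
  where "mev f m = (\<Prod>i\<in>UNIV. f i ^ Poly_Mapping.lookup m i)"

lemma mev_0 [simp]: "mev f 0 = 1"
  by (simp add: mev_def)

lemma mev_add: "mev f (m + m') = mev f m * mev f m'"
  by (simp add: mev_def lookup_add power_add prod.distrib)

lemma mev_single: "mev f (Poly_Mapping.single i 1) = f i"
proof -
  have "mev f (Poly_Mapping.single i 1) = (\<Prod>j\<in>UNIV. if j = i then f j else 1)"
    unfolding mev_def by (rule prod.cong) (auto simp: lookup_single when_def)
  then show ?thesis by simp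
qed

definition subst :: "('n::finite \<Rightarrow> ('n, 'k::field) mpol) \<Rightarrow> ('n, 'k) mpol \<Rightarrow> ('n, 'k) mpol"
  where "subst f p = (\<Sum>m\<in>Poly_Mapping.keys p. cst (Poly_Mapping.lookup p m) * mev f m)"

lemma subst_superset:
  assumes "finite S" "Poly_Mapping.keys p \<subseteq> S"
  shows "subst f p = (\<Sum>m\<in>S. cst (Poly_Mapping.lookup p m) * mev f m)"
  unfolding subst_def using assms
  by (intro sum.mono_neutral_left) (auto simp: in_keys_iff)

lemma subst_add: "subst f (p + q) = subst f p + subst f q"
proof -
  let ?S = "Poly_Mapping.keys p \<union> Poly_Mapping.keys q"
  have "Poly_Mapping.keys (p + q) \<subseteq> ?S" by (rule Poly_Mapping.keys_add)
  then show ?thesis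
    by (simp add: subst_superset[of ?S] lookup_add cst_add distrib_right sum.distrib)
qed

lemma subst_0 [simp]: "subst f 0 = 0"
  by (simp add: subst_def)

lemma subst_single: "subst f (Poly_Mapping.single m c) = cst c * mev f m"
  by (cases "c = 0") (simp_all add: subst_def)

lemma subst_cst [simp]: "subst f (cst c) = cst c"
  by (simp add: subst_single[of f 0 c, folded cst_def])

lemma subst_1 [simp]: "subst f 1 = 1"
  using subst_cst[of f 1] by simp

lemma subst_xpow [simp]: "subst f (xpow m) = mev f m"
  by (simp add: xpow_def subst_single)

lemma subst_mult: "subst f (p * q) = subst f p * subst f q"
proof (induction p rule: poly_mapping_add_single_induct)
  case (add m c p)
  have "subst f (Poly_Mapping.single m c * q) = subst f (Poly_Mapping.single m c) * subst f q"
    by (induction q rule: poly_mapping_add_single_induct)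
      (simp_all add: mult_single subst_single mev_add subst_add cst_mult distrib_left)
  with add show ?case by (simp add: subst_add distrib_right)
qed simp

lemma subst_sum: "subst f (sum g S) = (\<Sum>x\<in>S. subst f (g x))"
  by (induction S rule: infinite_finite_induct) (simp_all add: subst_add)

lemma subst_uminus: "subst f (- p) = - subst f p"
  using subst_add[of f p "- p"] by (simp add: eq_neg_iff_add_eq_0 add.commute)

lemma subst_diff: "subst f (p - q) = subst f p - subst f q"
  using subst_add[of f p "- q"] by (simp add: subst_uminus)

lemma xpow_0: "xpow 0 = 1"
  by (simp add: xpow_def)

lemma xpow_add: "xpow (m + m') = xpow m * xpow m'"
  by (simp add: xpow_def mult_single)

lemma cst_mult_xpow: "cst c * xpow m = Poly_Mapping.single m c"
  by (simp add: xpow_def cst_def mult_single)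

lemma mpol_as_sum: "p = (\<Sum>m\<in>Poly_Mapping.keys p. cst (Poly_Mapping.lookup p m) * xpow m)"
  by (rule poly_mapping_eqI)
    (auto simp: cst_mult_xpow lookup_sum lookup_single when_def in_keys_iff sum.delta')

lemma mev_var: "mev var m = (xpow m :: ('n::finite, 'k::field) mpol)"
proof (induction m rule: poly_mapping_add_single_induct)
  case (add i k m)
  have "mev var (Poly_Mapping.single i k) = (xpow (Poly_Mapping.single i k) :: ('n, 'k) mpol)"
  proof (induction k)
    case (Suc k)
    have "Poly_Mapping.single i (Suc k) = Poly_Mapping.single i 1 + Poly_Mapping.single i k"
      by (simp flip: single_add)
    with Suc show ?case by (simp only: mev_add xpow_add mev_single var_def)
  qed (simp add: xpow_0)
  with add show ?case by (simp add: mev_add xpow_add)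
qed (simp add: xpow_0)

section \<open>Weights and derivatives of monomials\<close>

definition wt :: "('n::finite \<Rightarrow> nat) \<Rightarrow> 'n mon \<Rightarrow> nat"
  where "wt w m = (\<Sum>i\<in>UNIV. Poly_Mapping.lookup m i * w i)"

abbreviation mdeg :: "'n::finite mon \<Rightarrow> nat"
  where "mdeg \<equiv> wt (\<lambda>_. 1)"

lemma wt_add: "wt w (m + m') = wt w m + wt w m'"
  by (simp add: wt_def lookup_add distrib_right sum.distrib)

lemma wt_single [simp]: "wt w (Poly_Mapping.single i 1) = w i"
proof -
  have "wt w (Poly_Mapping.single i 1) = (\<Sum>j\<in>UNIV. if j = i then w j else 0)"
    unfolding wt_def by (rule sum.cong) (auto simp: lookup_single when_def)
  then show ?thesis by simp
qed

lemma mon_minus_plus: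
  assumes "Poly_Mapping.lookup m i \<noteq> 0"
  shows "(m - Poly_Mapping.single i 1) + Poly_Mapping.single i 1 = (m :: 'n mon)"
  using assms by (intro poly_mapping_eqI) (auto simp: lookup_add lookup_minus lookup_single when_def)

lemma cst_prod: "cst (prod f S) = (\<Prod>x\<in>S. cst (f x))"
  by (induction S rule: infinite_finite_induct) (simp_all add: cst_mult)

lemma mev_scale:
  fixes f :: "'n::finite \<Rightarrow> ('n, 'k::field) mpol"
  shows "mev (\<lambda>i. cst (t ^ w i) * f i) m = cst (t ^ wt w m) * mev f m"
proof -
  have "(cst (t ^ wt w m) :: ('n, 'k) mpol) = (\<Prod>i\<in>UNIV. cst (t ^ w i) ^ Poly_Mapping.lookup m i)"
    by (simp add: wt_def power_sum cst_prod cst_power mult.commute power_mult)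
  then show ?thesis
    by (simp add: mev_def power_mult_distrib prod.distrib)
qed

text \<open>The curve through the tuple \<open>f\<close> on which the entry \<open>i\<close> moves with velocity \<open>q\<close>.\<close>

definition line :: "('n \<Rightarrow> 'r::comm_semiring_1) \<Rightarrow> 'n \<Rightarrow> 'r \<Rightarrow> 'n \<Rightarrow> 'r poly"
  where "line f i q j = (if j = i then [:f i, q:] else [:f j:])"

lemma poly_mev: "poly (mev F m) s = mev (\<lambda>j. poly (F j) s) m"
  by (simp add: mev_def poly_prod)

lemma coeff_0_mev_line: "coeff (mev (line f i q) m) 0 = mev f m"
proof -
  have "poly (line f i q j) 0 = f j" for j by (simp add: line_def)
  then show ?thesis by (simp add: poly_mev flip: poly_0_coeff_0)
qed

lemma coeff_1_linear_power:
  "coeff ([:a, q:] ^ n) (Suc 0) = of_nat n * a ^ (n - 1) * (q :: 'r::comm_semiring_1)"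
proof (induction n)
  case (Suc n)
  have c0: "coeff ([:a, q:] ^ n) 0 = a ^ n"
    by (simp add: flip: poly_0_coeff_0)
  have "coeff ([:a, q:] ^ Suc n) (Suc 0) = a * coeff ([:a, q:] ^ n) (Suc 0) + q * a ^ n"
    by (simp add: c0)
  then show ?case unfolding Suc
    by (cases n) (simp_all add: algebra_simps)
qed simp

lemma prod_const_poly: "(\<Prod>j\<in>S. [:g j:]) = [:\<Prod>j\<in>S. g j :: 'r::comm_semiring_1:]"
  by (induction S rule: infinite_finite_induct) (simp_all add: one_pCons mult.commute)

text \<open>The derivative at \<open>t = 0\<close> of the value of \<open>m\<close>, when the entry \<open>i\<close> moves with the velocity given by
the monomial \<open>q\<close>: the derivation \<open>q \<partial>/\<partial>x\<^sub>i\<close> applied to \<open>m\<close>, evaluated at \<open>f\<close>.\<close>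

lemma coeff_1_mev_line:
  "coeff (mev (line f i (mev f q)) m) 1 =
    of_nat (Poly_Mapping.lookup m i) * mev f (m - Poly_Mapping.single i 1 + q)"
proof -
  define e where "e = Poly_Mapping.lookup m i"
  define r where "r = (\<Prod>j\<in>UNIV - {i}. f j ^ Poly_Mapping.lookup m j)"
  have "mev (line f i (mev f q)) m =
      line f i (mev f q) i ^ e * (\<Prod>j\<in>UNIV - {i}. line f i (mev f q) j ^ Poly_Mapping.lookup m j)"
    unfolding mev_def e_def by (rule prod.remove) auto
  also have "(\<Prod>j\<in>UNIV - {i}. line f i (mev f q) j ^ Poly_Mapping.lookup m j) =
      (\<Prod>j\<in>UNIV - {i}. [:f j ^ Poly_Mapping.lookup m j:])"
    by (rule prod.cong) (auto simp: line_def poly_const_pow)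
  also have "\<dots> = [:r:]"
    unfolding r_def by (rule prod_const_poly)
  finally have "mev (line f i (mev f q)) m = [:f i, mev f q:] ^ e * [:r:]"
    by (subst (asm) (2) line_def) simp
  then have 1: "coeff (mev (line f i (mev f q)) m) 1 = of_nat e * f i ^ (e - 1) * mev f q * r"
    by (simp add: coeff_1_linear_power mult.commute)
  show ?thesis
  proof (cases "e = 0")
    case False
    have "mev f (m - Poly_Mapping.single i 1) = f i ^ (e - 1) *
        (\<Prod>j\<in>UNIV - {i}. f j ^ Poly_Mapping.lookup (m - Poly_Mapping.single i 1) j)"
      unfolding mev_def e_def
      by (subst prod.remove[of _ i]) (auto simp: lookup_minus)
    also have "(\<Prod>j\<in>UNIV - {i}. f j ^ Poly_Mapping.lookup (m - Poly_Mapping.single i 1) j) = r"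
      unfolding r_def by (rule prod.cong) (auto simp: lookup_minus lookup_single when_def)
    finally show ?thesis using 1 by (simp add: mev_add e_def mult_ac)
  qed (use 1 in \<open>simp add: e_def\<close>)
qed

section \<open>Separating weights\<close>

lemma digits_unique:
  fixes a b :: "nat \<Rightarrow> nat"
  assumes "(\<Sum>k<n. a k * E ^ k) = (\<Sum>k<n. b k * E ^ k)" "\<And>k. a k < E" "\<And>k. b k < E" "k < n"
  shows "a k = b k"
  using assms
proof (induction n arbitrary: a b k)
  case (Suc n)
  have eq: "a 0 + E * (\<Sum>k<n. a (Suc k) * E ^ k) = b 0 + E * (\<Sum>k<n. b (Suc k) * E ^ k)"
    using Suc.prems(1) by (simp add: sum.lessThan_Suc_shift sum_distrib_left mult_ac del: sum.lessThan_Suc)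
  have 0: "a 0 = b 0"
    using arg_cong[OF eq, of "\<lambda>x. x mod E"] Suc.prems(2,3)[of 0] by simp
  with eq Suc.prems(2)[of 0] have "(\<Sum>k<n. a (Suc k) * E ^ k) = (\<Sum>k<n. b (Suc k) * E ^ k)"
    by simp
  from Suc.IH[OF this] Suc.prems 0 show ?case by (cases k) auto
qed simp

text \<open>The weight of \<open>x\<^sub>i\<close> is a large constant plus a power of \<open>E > D\<close>. The constant \<open>E ^ n\<close>
exceeds the contribution of these powers in degree at most \<open>D\<close>, so the weight determines the degree
there, and what remains encodes the exponents as digits in base \<open>E\<close>. The same constant makes a
product of two variables heavier than any variable.\<close>

lemma separating_weights:
  fixes D :: nat
  obtains w :: "'n::{finite,linorder} \<Rightarrow> nat"
  where "inj_on (wt w) {m. mdeg m \<le> D}"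
    and "\<And>m m'. mdeg m' \<le> D \<Longrightarrow> D < mdeg m \<Longrightarrow> wt w m' < wt w m"
    and "\<And>i j. j < i \<Longrightarrow> w i < w j"
    and "\<And>i j k. w i < w j + w k"
proof -
  define E where "E = D + 2"
  define n where "n = card (UNIV :: 'n set)"
  define r where "r i = card {j. i < j}" for i :: 'n
  define w where "w i = E ^ n + E ^ r i" for i
  define s where "s = wt (\<lambda>i. E ^ r i)"
  have r_mono: "r i < r j" if "j < i" for i j
    unfolding r_def using that by (intro psubset_card_mono) auto
  have r_less: "r i < n" for i
    unfolding r_def n_def by (intro psubset_card_mono) auto
  have inj_r: "inj r" using r_mono by (metis injI linorder_neqE less_irrefl)
  have "r ` UNIV = {..<n}"
    by (rule card_subset_eq) (use r_less in \<open>auto simp: card_image[OF inj_r] n_def\<close>)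
  then have bij_r: "bij_betw r UNIV {..<n}" using inj_r by (simp add: bij_betw_def)
  have wt_w: "wt w m = E ^ n * mdeg m + s m" for m
    by (simp add: wt_def w_def s_def sum.distrib sum_distrib_left algebra_simps)
  have s_less: "s m < E ^ n" if "mdeg m \<le> D" for m
  proof -
    obtain n' where n': "n = Suc n'" using r_less by (metis less_nat_zero_code old.nat.exhaust)
    have "s m \<le> (\<Sum>i\<in>UNIV. Poly_Mapping.lookup m i * E ^ n')"
      unfolding s_def wt_def using r_less n'
      by (intro sum_mono mult_left_mono power_increasing) (auto simp: E_def less_Suc_eq_le)
    also have "\<dots> = mdeg m * E ^ n'" by (simp add: wt_def sum_distrib_right)
    also have "\<dots> < E * E ^ n'" using that by (intro mult_strict_right_mono) (auto simp: E_def)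
    finally show ?thesis by (simp add: n')
  qed
  have inj: "m = m'" if eq: "wt w m = wt w m'" and deg: "mdeg m \<le> D" "mdeg m' \<le> D" for m m'
  proof -
    have "s m = s m'"
      using arg_cong[OF eq, of "\<lambda>x. x mod E ^ n"] s_less deg by (simp add: wt_w)
    have lookup_le: "Poly_Mapping.lookup m i \<le> mdeg m" for m :: "'n mon" and i
      by (simp add: wt_def member_le_sum)
    define ri where "ri = inv_into UNIV r"
    have ri: "ri (r i) = i" for i using inj_r by (simp add: ri_def)
    have s_digits: "s m = (\<Sum>k<n. Poly_Mapping.lookup m (ri k) * E ^ k)" for m
      unfolding s_def wt_def using sum.reindex_bij_betw[OF bij_r,
          of "\<lambda>k. Poly_Mapping.lookup m (ri k) * E ^ k"] by (simp add: ri)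
    have "Poly_Mapping.lookup m (ri (r i)) = Poly_Mapping.lookup m' (ri (r i))" for i
    proof (rule digits_unique[of "\<lambda>k. Poly_Mapping.lookup m (ri k)" E n
          "\<lambda>k. Poly_Mapping.lookup m' (ri k)"])
      show "(\<Sum>k<n. Poly_Mapping.lookup m (ri k) * E ^ k) =
          (\<Sum>k<n. Poly_Mapping.lookup m' (ri k) * E ^ k)"
        using \<open>s m = s m'\<close> by (simp add: s_digits)
      show "Poly_Mapping.lookup m (ri k) < E" "Poly_Mapping.lookup m' (ri k) < E" for k
        using lookup_le[of m "ri k"] lookup_le[of m' "ri k"] deg by (auto simp: E_def)
      show "r i < n" by (rule r_less)
    qed
    then show ?thesis by (intro poly_mapping_eqI) (simp add: ri)
  qed
  show ?thesis
  proof
    show "inj_on (wt w) {m. mdeg m \<le> D}" using inj by (auto simp: inj_on_def)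
    show "wt w m' < wt w m" if "mdeg m' \<le> D" "D < mdeg m" for m m'
    proof -
      have "wt w m' < E ^ n * Suc (mdeg m')" using s_less[OF that(1)] by (simp add: wt_w)
      also have "\<dots> \<le> E ^ n * mdeg m" using that by (intro mult_left_mono) auto
      also have "\<dots> \<le> wt w m" by (simp add: wt_w)
      finally show ?thesis .
    qed
    show "w i < w j" if "j < i" for i j
      using r_mono[OF that] by (auto simp: w_def E_def intro: power_strict_increasing)
    show "w i < w j + w k" for i j k
    proof -
      have "E ^ r i < E ^ n" using r_less[of i] by (intro power_strict_increasing) (auto simp: E_def)
      then show ?thesis by (simp add: w_def)
    qed
  qed
qed

section \<open>Monomial bases of minimal weight\<close>

lemma cst_of_nat: "of_nat n = cst (of_nat n)"
  by (induction n) (simp_all add: cst_add)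

lemma wt_pos_imp_mdeg_pos: "0 < wt w m \<Longrightarrow> 0 < mdeg m"
  by (rule ccontr) (simp add: wt_def)

lemmas wt_single_Suc [simp] = wt_single[unfolded One_nat_def]

text \<open>The extremal situation: no set of monomials of degree at most \<open>D\<close> whose values at some tuple form
a basis of \<open>R/J\<close> has a smaller total weight than \<open>B\<close>.\<close>

locale minimal_monomial_basis = poly_ideal J
  for J :: "('n::{finite,linorder}, 'k::field_char_0) mpol set" +
  fixes D :: nat and w :: "'n \<Rightarrow> nat" and B :: "'n mon set" and f :: "'n \<Rightarrow> ('n, 'k) mpol"
  assumes inj_wt: "inj_on (wt w) {m. mdeg m \<le> D}"
    and wt_less: "mdeg m' \<le> D \<Longrightarrow> D < mdeg m \<Longrightarrow> wt w m' < wt w m"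
    and mdeg_B: "b \<in> B \<Longrightarrow> mdeg b \<le> D"
    and basis: "basis_mod J B (mev f)"
    and minimal: "(\<And>c. c \<in> C \<Longrightarrow> mdeg c \<le> D) \<Longrightarrow> basis_mod J C (mev h) \<Longrightarrow>
      sum (wt w) B \<le> sum (wt w) C"
begin

definition coef :: "'n mon \<Rightarrow> 'n mon \<Rightarrow> 'k"
  where "coef m = coeff_mod J B (mev f) (mev f m)"

lemma finite_B: "finite B"
  using basis by (rule basis_modD)

lemma coef: "mev f m - (\<Sum>b\<in>B. cst (coef m b) * mev f b) \<in> J"
  unfolding coef_def by (rule coeff_mod[OF basis])

lemma coef_self: "b \<in> B \<Longrightarrow> b' \<in> B \<Longrightarrow> coef b b' = (if b' = b then 1 else 0)"
  unfolding coef_def by (rule coeff_mod_basis[OF basis])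

lemma exchange_wt_le:
  assumes "basis_mod J (insert m (B - {b})) (mev h)" "mdeg m \<le> D" "b \<in> B" "m \<notin> B"
  shows "wt w b \<le> wt w m"
proof -
  have "sum (wt w) B \<le> sum (wt w) (insert m (B - {b}))"
    using assms(1,2) mdeg_B by (intro minimal) auto
  also have "\<dots> = wt w m + sum (wt w) (B - {b})"
    using finite_B assms(4) by simp
  finally show ?thesis using finite_B assms(3) by (simp add: sum.remove)
qed

text \<open>For \<open>m\<close> of degree at most \<open>D\<close>, a monomial \<open>b\<close> that occurs in the expansion of \<open>m\<close> can be exchanged
for \<open>m\<close>, so minimality bounds its weight, and strictly since weights separate monomials. If the
degree of \<open>m\<close> exceeds \<open>D\<close>, then \<open>m\<close> is heavier than all of \<open>B\<close>.\<close>

lemma coef_nonzero_imp_wt_less: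
  assumes "m \<notin> B" "b \<in> B" "coef m b \<noteq> 0"
  shows "wt w b < wt w m"
proof (cases "mdeg m \<le> D")
  case True
  have "basis_mod J (insert m (B - {b})) (mev f)"
    using assms by (intro basis_mod_exchange[OF basis]) (auto simp: coef_def)
  then have "wt w b \<le> wt w m" using True assms(1,2) by (intro exchange_wt_le)
  moreover have "wt w b \<noteq> wt w m"
    using inj_wt True mdeg_B[OF assms(2)] assms(1,2) by (auto simp: inj_on_def)
  ultimately show ?thesis by simp
next
  case False
  then show ?thesis using wt_less mdeg_B[OF assms(2)] by simp
qed

lemma coef_nonzero_imp_wt_le:
  assumes "b \<in> B" "coef m b \<noteq> 0"
  shows "wt w b \<le> wt w m"
proof (cases "m \<in> B")
  case True
  with assms show ?thesis by (auto simp: coef_self split: if_splits)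
next
  case False
  with assms show ?thesis using coef_nonzero_imp_wt_less by force
qed

text \<open>A monomial outside \<open>B\<close> is congruent to a combination of lighter ones. Multiplication by \<open>q\<close>
preserves this, whereas an element of \<open>B\<close> is not congruent to a combination of lighter monomials.\<close>

lemma complement_closed:
  assumes "m \<notin> B"
  shows "m + q \<notin> B"
proof
  assume q: "m + q \<in> B"
  have "mev f (m + q) - (\<Sum>b\<in>B. cst (coef m b) * mev f (b + q)) \<in> J"
    using mult_mem[OF coef[of m], of "mev f q"]
    by (simp add: right_diff_distrib sum_distrib_left mev_add mult_ac)
  from coeff_mod_cong[OF basis this q]
  have "coef (m + q) (m + q) = (\<Sum>b\<in>B. coef m b * coef (b + q) (m + q))"
    by (simp add: coef_def coeff_mod_sum[OF basis q] coeff_mod_scale[OF basis q])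
  then have "(\<Sum>b\<in>B. coef m b * coef (b + q) (m + q)) \<noteq> 0"
    using q by (simp add: coef_self)
  then obtain b where "b \<in> B" "coef m b * coef (b + q) (m + q) \<noteq> 0"
    by (rule sum.not_neutral_contains_not_neutral)
  then have b: "b \<in> B" "coef m b \<noteq> 0" "coef (b + q) (m + q) \<noteq> 0" by auto
  have "wt w b < wt w m" using assms b by (intro coef_nonzero_imp_wt_less)
  moreover have "wt w (m + q) \<le> wt w (b + q)" using q b by (intro coef_nonzero_imp_wt_le)
  ultimately show False by (simp add: wt_add)
qed

text \<open>Otherwise let \<open>s = m + q\<close> be in \<open>B\<close>, let \<open>p = m + e\<^sub>i\<close> be outside \<open>B\<close>, and move \<open>f\<^sub>i\<close> along
\<open>f\<^sub>i + t q(f)\<close>. The difference \<open>U\<close> between \<open>p\<close> and its expansion at \<open>t = 0\<close>, both evaluated along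
this curve, vanishes at \<open>t = 0\<close> modulo \<open>J\<close>. Its derivative there has a nonzero coordinate at \<open>s\<close>: the
monomial \<open>p\<close> contributes its exponent at \<open>i\<close>, which is invertible in characteristic zero, and the
monomials of the expansion contribute nothing since they are lighter than \<open>p\<close>. So \<open>U / t\<close> can replace
\<open>s\<close> in the basis at \<open>t = 0\<close>, hence also at some \<open>t \<noteq> 0\<close>, and there \<open>p\<close> itself can replace \<open>s\<close>. As \<open>p\<close>
is lighter than \<open>s\<close>, this contradicts minimality.\<close>

lemma complement_sheared:
  assumes p: "m + Poly_Mapping.single i 1 \<notin> B" and wq: "w i < wt w q"
  shows "m + q \<notin> B"
proof
  assume s: "m + q \<in> B"
  define p s e where "p = m + Poly_Mapping.single i 1" and "s = m + q"
    and "e = Poly_Mapping.lookup p i"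
  have s: "s \<in> B" and p: "p \<notin> B" using s p by (auto simp: s_def p_def)
  have wt_ps: "wt w p < wt w s" using wq by (simp add: p_def s_def wt_add)
  have "0 < mdeg q" using wq by (intro wt_pos_imp_mdeg_pos[of w]) simp
  then have "mdeg p \<le> mdeg s" by (simp only: p_def s_def wt_add wt_single)
  with mdeg_B[OF s] have deg_p: "mdeg p \<le> D" by simp
  have e: "e > 0" by (simp add: e_def p_def lookup_add)
  have p_s: "p - Poly_Mapping.single i 1 + q = s" by (simp add: p_def s_def)
  have coef_ps: "coef p s = 0"
    using coef_nonzero_imp_wt_less[OF p s] wt_ps by fastforce

  define P where "P = mev (line f i (mev f q))"
  define U where "U = P p - (\<Sum>b\<in>B. [:cst (coef p b):] * P b)"
  obtain u0 U1 where U: "U = pCons u0 U1" by (cases U)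
  have P0: "poly (P b) 0 = mev f b" for b
    by (simp add: P_def poly_0_coeff_0 coeff_0_mev_line)
  have "u0 = coeff U 0" using U by simp
  also have "\<dots> = mev f p - (\<Sum>b\<in>B. cst (coef p b) * mev f b)"
    using P0 by (simp add: U_def coeff_sum poly_0_coeff_0)
  finally have u0: "u0 \<in> J" using coef by simp
  have "coeff U1 0 = coeff U 1" using U by simp
  also have "\<dots> = cst (of_nat e) * mev f s - (\<Sum>b\<in>B. cst (coef p b * of_nat (Poly_Mapping.lookup b i)) *
      mev f (b - Poly_Mapping.single i 1 + q))"
    by (simp add: U_def coeff_sum P_def coeff_1_mev_line[simplified] p_s[simplified] cst_of_nat
        cst_mult mult.assoc flip: e_def)
  finally have U1: "poly U1 0 = \<dots>" by (simp add: poly_0_coeff_0)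
  have "coeff_mod J B (mev f) (poly U1 0) s = of_nat e * coef s s -
      (\<Sum>b\<in>B. coef p b * of_nat (Poly_Mapping.lookup b i) * coef (b - Poly_Mapping.single i 1 + q) s)"
    unfolding U1 by (simp add: coef_def coeff_mod_diff[OF basis s] coeff_mod_sum[OF basis s]
        coeff_mod_scale[OF basis s])
  also have "(\<Sum>b\<in>B. coef p b * of_nat (Poly_Mapping.lookup b i) *
      coef (b - Poly_Mapping.single i 1 + q) s) = 0"
  proof (rule sum.neutral, rule ballI, rule ccontr)
    fix b assume b: "b \<in> B" and nz: "coef p b * of_nat (Poly_Mapping.lookup b i) *
      coef (b - Poly_Mapping.single i 1 + q) s \<noteq> 0"
    have "b - Poly_Mapping.single i 1 + Poly_Mapping.single i 1 = b"
      using nz by (intro mon_minus_plus) auto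
    then have "wt w b = wt w (b - Poly_Mapping.single i 1) + w i"
      by (metis wt_add wt_single)
    moreover have "wt w b < wt w p"
      using p b nz by (intro coef_nonzero_imp_wt_less) auto
    moreover have "wt w s \<le> wt w (b - Poly_Mapping.single i 1 + q)"
      using s nz by (intro coef_nonzero_imp_wt_le) auto
    ultimately show False
      by (simp only: p_def s_def wt_add wt_single)
  qed
  finally have nz: "coeff_mod J B (mev f) (poly U1 0) s \<noteq> 0"
    using e s by (simp add: coef_self)

  \<comment> \<open>the curves in which \<open>U1\<close>, which is \<open>U / t\<close> modulo \<open>J\<close> away from \<open>t = 0\<close>, takes the place of \<open>s\<close>\<close>
  define G where "G b = (if b = s then U1 else P b)" for b
  have "basis_mod J (insert s (B - {s})) (\<lambda>b. poly (G b) 0)"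
    using nz by (intro basis_mod_exchange[OF basis s]) (auto simp: G_def P0)
  then have "basis_mod J B (\<lambda>b. poly (G b) 0)"
    using s by (simp add: insert_absorb)
  from basis_mod_nearby[OF poly_ideal_axioms this] obtain t
    where t: "t \<noteq> 0" and basis_t: "basis_mod J B (\<lambda>b. poly (G b) (cst t))" by blast
  define h where "h = (\<lambda>j. poly (line f i (mev f q) j) (cst t))"
  have Pt: "poly (P b) (cst t) = mev h b" for b
    by (simp add: P_def poly_mev h_def)
  have "mev h p = poly U (cst t) + (\<Sum>b\<in>B. cst (coef p b) * mev h b)"
    by (simp add: U_def Pt poly_sum)
  also have "\<dots> = u0 + cst t * poly U1 (cst t) + (\<Sum>b\<in>B - {s}. cst (coef p b) * mev h b)"
    using finite_B s coef_ps by (simp add: U sum.remove)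
  also have "\<dots> = u0 + (\<Sum>b\<in>B. cst (if b = s then t else coef p b) * poly (G b) (cst t))"
    using finite_B s by (simp add: sum.remove G_def Pt)
  finally have "mev h p - (\<Sum>b\<in>B. cst (if b = s then t else coef p b) * poly (G b) (cst t)) \<in> J"
    using u0 by simp
  from coeff_mod_unique[OF basis_t this s] t
  have "coeff_mod J B (\<lambda>b. poly (G b) (cst t)) (mev h p) s \<noteq> 0" by simp
  then have "basis_mod J (insert p (B - {s})) (mev h)"
    using p by (intro basis_mod_exchange[OF basis_t s]) (auto simp: G_def Pt)
  then have "wt w s \<le> wt w p" using deg_p s p by (intro exchange_wt_le)
  with wt_ps show False by simp
qed

end

section \<open>Presentations of algebras\<close>

lemma poly_algebra_simps [simp]:
  "zero poly_algebra = 0" "one poly_algebra = 1"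
  "p \<oplus>\<^bsub>poly_algebra\<^esub> q = p + q" "p \<otimes>\<^bsub>poly_algebra\<^esub> q = p * q"
  "c \<odot>\<^bsub>poly_algebra\<^esub> p = cst c * p"
  by (simp_all add: poly_algebra_def cst_def)

lemma cring_poly_algebra: "cring (poly_algebra :: ('k::field, ('n, 'k) mpol) module)"
  by (rule Module.algebra.axioms(2)[OF poly_algebra_algebra])

lemma ring_poly_algebra: "ring (poly_algebra :: ('k::field, ('n, 'k) mpol) module)"
  using cring_poly_algebra by (rule cring.axioms(1))

lemma uminus_poly_algebra [simp]:
  "\<ominus>\<^bsub>poly_algebra\<^esub> p = - (p :: ('n, 'k::field) mpol)"
proof -
  interpret ring "poly_algebra :: ('k, ('n, 'k) mpol) module" by (rule ring_poly_algebra)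
  show ?thesis by (rule minus_equality) auto
qed

lemma ideal_poly_algebra_iff:
  "ideal J (poly_algebra :: ('k::field, ('n, 'k) mpol) module) \<longleftrightarrow> poly_ideal J"
proof
  assume "ideal J (poly_algebra :: ('k, ('n, 'k) mpol) module)"
  then interpret I: ideal J "poly_algebra :: ('k, ('n, 'k) mpol) module" .
  show "poly_ideal J"
    using additive_subgroup.zero_closed[OF I.additive_subgroup_axioms]
      additive_subgroup.a_closed[OF I.additive_subgroup_axioms] I.I_l_closed
    by unfold_locales simp_all
next
  assume "poly_ideal J"
  then interpret poly_ideal J .
  interpret R: ring "poly_algebra :: ('k, ('n, 'k) mpol) module" by (rule ring_poly_algebra)
  show "ideal J (poly_algebra :: ('k, ('n, 'k) mpol) module)"
  proof (rule idealI[OF ring_poly_algebra])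
    show "subgroup J (add_monoid (poly_algebra :: ('k, ('n, 'k) mpol) module))"
    proof (rule subgroup.intro)
      show "inv\<^bsub>add_monoid poly_algebra\<^esub> p \<in> J" if "p \<in> J" for p
        using uminus_mem[OF that] uminus_poly_algebra[of p] by (simp only: a_inv_def)
    qed (auto intro: add_mem)
    show "a \<otimes>\<^bsub>poly_algebra\<^esub> x \<in> J" "x \<otimes>\<^bsub>poly_algebra\<^esub> a \<in> J" if "a \<in> J" for a x
      using mult_mem[OF that, of x] by (simp_all add: mult.commute)
  qed
qed

text \<open>A surjective algebra homomorphism from the polynomial ring onto \<open>A\<close> with kernel \<open>J\<close>. It gives access
to \<open>A\<close> through computations with polynomials modulo \<open>J\<close>, and serves both for the given algebra and for
the quotient algebras that define the charts.\<close>

locale presentation =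
  fixes A :: "('k::field, 'a) module" and h :: "('n, 'k) mpol \<Rightarrow> 'a" and J :: "('n, 'k) mpol set"
  assumes algebra: "Module.algebra class_ring A"
    and surj: "range h = carrier A"
    and hom_add: "h (p + q) = h p \<oplus>\<^bsub>A\<^esub> h q"
    and hom_mult: "h (p * q) = h p \<otimes>\<^bsub>A\<^esub> h q"
    and hom_one: "h 1 = \<one>\<^bsub>A\<^esub>"
    and hom_scale: "h (cst c * p) = c \<odot>\<^bsub>A\<^esub> h p"
    and kernel: "h p = \<zero>\<^bsub>A\<^esub> \<longleftrightarrow> p \<in> J"
begin

sublocale A: Module.algebra class_ring A
  by (rule algebra)

sublocale V: vectorspace class_ring A
  using algebra class_field by (simp add: vectorspace_def Module.algebra_def)

lemma closed [simp]: "h p \<in> carrier A"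
  using surj by auto

lemma hom_zero: "h 0 = \<zero>\<^bsub>A\<^esub>"
proof -
  have "h 0 \<oplus>\<^bsub>A\<^esub> h 0 = h 0" by (simp flip: hom_add)
  then show ?thesis using A.add.l_cancel_one[of "h 0" "h 0"] by simp
qed

sublocale poly_ideal J
proof
  show "0 \<in> J" using hom_zero kernel by blast
  show "p + q \<in> J" if "p \<in> J" "q \<in> J" for p q
    using that by (simp add: hom_add flip: kernel)
  show "r * p \<in> J" if "p \<in> J" for p r
    using that by (simp add: hom_mult flip: kernel)
qed

lemma eq_iff: "h p = h q \<longleftrightarrow> p - q \<in> J"
proof -
  have *: "h p = h (p - q) \<oplus>\<^bsub>A\<^esub> h q" by (simp flip: hom_add)
  then have "h p = h q \<longleftrightarrow> h (p - q) = \<zero>\<^bsub>A\<^esub>"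
    using A.add.r_cancel_one[of "h q" "h (p - q)"] by auto
  then show ?thesis by (simp add: kernel)
qed

lemma hom_lincomb:
  assumes "finite B"
  shows "h (\<Sum>b\<in>B. cst (c b) * g b) = (\<Oplus>\<^bsub>A\<^esub>b\<in>B. c b \<odot>\<^bsub>A\<^esub> h (g b))"
  using assms
proof (induction B)
  case (insert b B)
  have "(\<lambda>b. c b \<odot>\<^bsub>A\<^esub> h (g b)) \<in> B \<rightarrow> carrier A"
    by (auto simp flip: hom_scale)
  moreover have "c b \<odot>\<^bsub>A\<^esub> h (g b) \<in> carrier A" by (simp flip: hom_scale)
  ultimately show ?case
    using insert by (simp add: hom_add hom_scale A.finsum_insert)
qed (simp add: hom_zero)

lemma lincomb_image:
  assumes "finite B" "inj_on (\<lambda>b. h (g b)) B"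
  shows "A.lincomb a ((\<lambda>b. h (g b)) ` B) = h (\<Sum>b\<in>B. cst (a (h (g b))) * g b)"
proof -
  have "(\<lambda>x. a x \<odot>\<^bsub>A\<^esub> x) \<in> (\<lambda>b. h (g b)) ` B \<rightarrow> carrier A"
    by (auto simp flip: hom_scale)
  from A.finsum_reindex[OF this assms(2)] show ?thesis
    by (simp add: A.lincomb_def hom_lincomb[OF assms(1)])
qed

lemma independent_image:
  assumes fin: "finite B" and indep: "\<And>c b. (\<Sum>b\<in>B. cst (c b) * g b) \<in> J \<Longrightarrow> b \<in> B \<Longrightarrow> c b = 0"
  shows "inj_on (\<lambda>b. h (g b)) B" "A.lin_indpt ((\<lambda>b. h (g b)) ` B)"
proof -
  show inj: "inj_on (\<lambda>b. h (g b)) B"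
  proof (rule inj_onI, rule ccontr)
    fix b b' assume b: "b \<in> B" "b' \<in> B" "h (g b) = h (g b')" "b \<noteq> b'"
    have "(\<Sum>x\<in>B. cst (if x = b then 1 else if x = b' then - 1 else 0) * g x) = g b - g b'"
      using fin b by (simp add: sum.remove[of B b] sum.remove[of "B - {b}" b'] cst_uminus)
    with indep[of "\<lambda>x. if x = b then 1 else if x = b' then - 1 else 0" b] b
    show False by (simp add: eq_iff)
  qed
  show "A.lin_indpt ((\<lambda>b. h (g b)) ` B)"
  proof (rule A.finite_lin_indpt2)
    fix a assume "A.lincomb a ((\<lambda>b. h (g b)) ` B) = \<zero>\<^bsub>A\<^esub>"
    then have "(\<Sum>b\<in>B. cst (a (h (g b))) * g b) \<in> J"
      by (simp add: lincomb_image[OF fin inj] kernel)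
    from indep[OF this] show "\<forall>v\<in>(\<lambda>b. h (g b)) ` B. a v = \<zero>\<^bsub>class_ring\<^esub>"
      by auto
  qed (use fin in auto)
qed

lemma basis_image:
  assumes B: "basis_mod J B g"
  shows "inj_on (\<lambda>b. h (g b)) B" "V.basis ((\<lambda>b. h (g b)) ` B)" "V.fin_dim" "V.dim = card B"
proof -
  note fin = basis_modD(1)[OF B] and indep = basis_modD(3)[OF B]
  show inj: "inj_on (\<lambda>b. h (g b)) B"
    by (rule independent_image(1)[of B g, OF fin]) (rule indep)
  have li: "A.lin_indpt ((\<lambda>b. h (g b)) ` B)"
    by (rule independent_image(2)[of B g, OF fin]) (rule indep)
  let ?X = "(\<lambda>b. h (g b)) ` B"
  have X: "?X \<subseteq> carrier A" by auto
  have "A.span ?X = carrier A"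
  proof
    show "A.span ?X \<subseteq> carrier A" using X by (rule A.span_is_subset2)
    show "carrier A \<subseteq> A.span ?X"
    proof
      fix v assume "v \<in> carrier A"
      then obtain r where r: "v = h r" using surj by auto
      obtain c where c: "r - (\<Sum>b\<in>B. cst (c b) * g b) \<in> J"
        using basis_modD(2)[OF B] by blast
      define a where "a v = c (the_inv_into B (\<lambda>b. h (g b)) v)" for v
      have "A.lincomb a ?X = h (\<Sum>b\<in>B. cst (c b) * g b)"
        unfolding lincomb_image[OF fin inj] a_def
        by (simp add: the_inv_into_f_f[OF inj] cong: sum.cong)
      also have "\<dots> = v" using c by (simp add: r eq_iff diff_mem_swap)
      finally show "v \<in> A.span ?X"
        unfolding A.finite_span[OF finite_imageI[OF fin] X] by auto
    qed
  qed
  then show basis: "V.basis ?X"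
    using li X by (auto simp: V.basis_def)
  show "V.fin_dim" using basis fin X by (auto simp: V.fin_dim_def V.basis_def)
  show "V.dim = card B"
    using V.dim_basis[OF finite_imageI[OF fin] basis] by (simp add: card_image[OF inj])
qed

text \<open>A set of monomials that is independent modulo \<open>J\<close> has at most \<open>dim A\<close> elements, so there is one of
maximal size, and it generates.\<close>

lemma monomial_basis_exists:
  assumes "V.fin_dim"
  obtains B where "basis_mod J B xpow"
proof -
  define indep where "indep B \<longleftrightarrow> finite B \<and>
    (\<forall>c. (\<Sum>b\<in>B. cst (c b) * xpow b) \<in> J \<longrightarrow> (\<forall>b\<in>B. c b = 0))" for B
  have bound: "card B \<le> V.dim" if "indep B" for B
  proof -
    have "finite B" using that by (simp add: indep_def)
    note * = independent_image[OF this, of xpow]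
    have "card ((\<lambda>b. h (xpow b)) ` B) \<le> V.dim"
      using that by (intro V.li_le_dim(2)[OF assms] *(2)) (auto simp: indep_def)
    moreover have "inj_on (\<lambda>b. h (xpow b)) B"
      using that by (intro *(1)) (auto simp: indep_def)
    ultimately show ?thesis by (simp add: card_image)
  qed
  have "indep {}" by (simp add: indep_def)
  moreover have "\<forall>B. indep B \<longrightarrow> card B < Suc V.dim" using bound by (simp add: less_Suc_eq_le)
  ultimately have "\<exists>B. indep B \<and> (\<forall>C. indep C \<longrightarrow> card C \<le> card B)"
    by (rule ex_has_greatest_nat)
  then obtain B where B: "indep B" and max: "\<And>C. indep C \<Longrightarrow> card C \<le> card B"
    by blast
  have fin: "finite B" using B by (simp add: indep_def)
  define T where "T = {r. \<exists>c. r - (\<Sum>b\<in>B. cst (c b) * xpow b) \<in> J}"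
  have T_lincomb: "cst a * r + s \<in> T" if rs: "r \<in> T" "s \<in> T" for a r s
  proof -
    obtain c c' where c: "r - (\<Sum>b\<in>B. cst (c b) * xpow b) \<in> J" "s - (\<Sum>b\<in>B. cst (c' b) * xpow b) \<in> J"
      using rs by (auto simp: T_def)
    have "cst a * r + s - (\<Sum>b\<in>B. cst (a * c b + c' b) * xpow b) \<in> J"
      using add_mem[OF mult_mem[OF c(1), of "cst a"] c(2)]
      by (simp add: cst_add cst_mult algebra_simps sum.distrib sum_distrib_left)
    then show ?thesis
      unfolding T_def by (intro CollectI exI[of _ "\<lambda>b. a * c b + c' b"])
  qed
  have T_xpow: "xpow m \<in> T" for m
  proof (cases "m \<in> B")
    case True
    have *: "xpow m - (\<Sum>b\<in>B. cst (if b = m then 1 else 0) * xpow b) = 0"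
      using fin True by (simp add: sum.remove[of B m])
    show ?thesis
      unfolding T_def
      by (intro CollectI exI[of _ "\<lambda>b. if b = m then 1 else 0"]) (simp only: * zero_mem)
  next
    case False
    then have "\<not> indep (insert m B)" using max[of "insert m B"] fin by auto
    then obtain c b where c: "(\<Sum>b\<in>insert m B. cst (c b) * xpow b) \<in> J" "b \<in> insert m B" "c b \<noteq> 0"
      using fin by (auto simp: indep_def)
    have c_sum: "cst (c m) * xpow m + (\<Sum>b\<in>B. cst (c b) * xpow b) \<in> J"
      using c(1) fin False by simp
    have cm: "c m \<noteq> 0"
      using c_sum c(2,3) B by (auto simp: indep_def)
    have "cst (1 / c m) * (cst (c m) * xpow m + (\<Sum>b\<in>B. cst (c b) * xpow b)) =
        xpow m - (\<Sum>b\<in>B. cst (- c b / c m) * xpow b)"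
      using cm by (simp add: distrib_left sum_distrib_left mult.assoc[symmetric] sum_negf cst_uminus
          flip: cst_mult)
    with mult_mem[OF c_sum, of "cst (1 / c m)"] show ?thesis unfolding T_def by auto
  qed
  have T0: "0 \<in> T" unfolding T_def by (intro CollectI exI[of _ "\<lambda>_. 0"]) simp
  have "r \<in> T" for r
  proof (induction r rule: poly_mapping_add_single_induct)
    case (add m c p)
    then show ?case using T_lincomb[OF T_xpow, of p c m] by (simp add: cst_mult_xpow)
  qed (rule T0)
  then have "basis_mod J B xpow"
    using B unfolding basis_mod_def indep_def T_def by blast
  then show ?thesis using that by blast
qed

end

lemma coset_poly_algebra:
  "J +>\<^bsub>poly_algebra\<^esub> p = (\<lambda>x. x + (p :: ('n, 'k::field) mpol)) ` J"
  by (auto simp: a_r_coset_def')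

lemma (in poly_ideal) coset_eq_iff:
  "J +>\<^bsub>poly_algebra\<^esub> p = J +>\<^bsub>poly_algebra\<^esub> q \<longleftrightarrow> p - q \<in> J"
proof
  assume "J +>\<^bsub>poly_algebra\<^esub> p = J +>\<^bsub>poly_algebra\<^esub> q"
  moreover have "p \<in> J +>\<^bsub>poly_algebra\<^esub> p"
    unfolding coset_poly_algebra by (rule image_eqI[of _ _ 0]) auto
  ultimately show "p - q \<in> J" unfolding coset_poly_algebra by auto
next
  assume pq: "p - q \<in> J"
  have *: "(\<lambda>x. x + p) ` J \<subseteq> (\<lambda>x. x + q) ` J" if "p - q \<in> J" for p q
  proof safe
    fix x assume "x \<in> J"
    then show "x + p \<in> (\<lambda>x. x + q) ` J"
      using add_mem[OF _ that, of x] by (intro image_eqI[of _ _ "x + (p - q)"]) auto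
  qed
  show "J +>\<^bsub>poly_algebra\<^esub> p = J +>\<^bsub>poly_algebra\<^esub> q"
    unfolding coset_poly_algebra using *[OF pq] *[OF diff_mem_swap[OF pq]] by blast
qed

lemma presentation_quotient:
  fixes J :: "('n, 'k::field) mpol set"
  assumes "poly_ideal J"
  shows "presentation (quot_algebra poly_algebra J) (\<lambda>p. J +>\<^bsub>poly_algebra\<^esub> p) J"
proof -
  interpret poly_ideal J by fact
  have ideal: "ideal J (poly_algebra :: ('k, ('n, 'k) mpol) module)"
    using assms by (simp add: ideal_poly_algebra_iff)
  interpret I: ideal J "poly_algebra :: ('k, ('n, 'k) mpol) module" by (rule ideal)
  note defs = quot_algebra_def ring.defs module.defs
  show ?thesis
  proof (rule presentation.intro)
    show "Module.algebra class_ring (quot_algebra poly_algebra J)"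
      by (rule quot_algebra_algebra[OF poly_algebra_algebra ideal])
    show "range (\<lambda>p. J +>\<^bsub>poly_algebra\<^esub> p) = carrier (quot_algebra poly_algebra J)"
      by (auto simp: defs FactRing_def A_RCOSETS_def')
    show "J +>\<^bsub>poly_algebra\<^esub> (p + q) =
      (J +>\<^bsub>poly_algebra\<^esub> p) \<oplus>\<^bsub>quot_algebra poly_algebra J\<^esub> (J +>\<^bsub>poly_algebra\<^esub> q)" for p q
      using I.a_rcos_sum[of p q] by (simp add: defs FactRing_def)
    show "J +>\<^bsub>poly_algebra\<^esub> (p * q) =
      (J +>\<^bsub>poly_algebra\<^esub> p) \<otimes>\<^bsub>quot_algebra poly_algebra J\<^esub> (J +>\<^bsub>poly_algebra\<^esub> q)" for p q
      using I.rcoset_mult_add[of p q] by (simp add: defs FactRing_def)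
    show "J +>\<^bsub>poly_algebra\<^esub> 1 = \<one>\<^bsub>quot_algebra poly_algebra J\<^esub>"
      by (simp add: defs FactRing_def)
    show "J +>\<^bsub>poly_algebra\<^esub> (cst c * p) =
      c \<odot>\<^bsub>quot_algebra poly_algebra J\<^esub> (J +>\<^bsub>poly_algebra\<^esub> p)" for c p
    proof -
      have "c \<odot>\<^bsub>quot_algebra poly_algebra J\<^esub> (J +>\<^bsub>poly_algebra\<^esub> p) =
          (\<Union>y\<in>J +>\<^bsub>poly_algebra\<^esub> p. J +>\<^bsub>poly_algebra\<^esub> (cst c * y))"
        by (simp add: defs)
      also have "\<dots> = J +>\<^bsub>poly_algebra\<^esub> (cst c * p)"
      proof (rule SUP_eq_const)
        show "J +>\<^bsub>poly_algebra\<^esub> p \<noteq> {}"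
          unfolding coset_poly_algebra using zero_mem by blast
        show "J +>\<^bsub>poly_algebra\<^esub> (cst c * y) = J +>\<^bsub>poly_algebra\<^esub> (cst c * p)"
          if "y \<in> J +>\<^bsub>poly_algebra\<^esub> p" for y
        proof -
          have "y - p \<in> J" using that by (auto simp: coset_poly_algebra)
          then show ?thesis unfolding coset_eq_iff by (rule mult_diff_mem)
        qed
      qed
      finally show ?thesis by (rule sym)
    qed
    show "J +>\<^bsub>poly_algebra\<^esub> p = \<zero>\<^bsub>quot_algebra poly_algebra J\<^esub> \<longleftrightarrow> p \<in> J" for p
      using coset_eq_iff[of p 0] by (simp add: defs FactRing_def coset_poly_algebra)
  qed
qed

lemma alg_isomorphic_imp_presentation:
  fixes A :: "('k::field, 'a) module" and J :: "('n, 'k) mpol set"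
  assumes A: "Module.algebra class_ring A" and J: "ideal J poly_algebra"
    and iso: "alg_isomorphic (quot_algebra poly_algebra J) A"
  obtains h where "presentation A h J"
proof -
  let ?Q = "quot_algebra poly_algebra J" and ?q = "\<lambda>p. J +>\<^bsub>poly_algebra\<^esub> p"
  interpret Q: presentation ?Q ?q J
    using J by (intro presentation_quotient) (simp add: ideal_poly_algebra_iff)
  interpret A: Module.algebra class_ring A by (rule A)
  obtain \<phi> where ring: "\<phi> \<in> ring_iso ?Q A" and lin: "\<phi> \<in> LinearCombinations.module_hom class_ring ?Q A"
    using iso by (auto simp: alg_isomorphic_def)
  have hom: "\<phi> \<in> Ring.ring_hom ?Q A" and bij: "bij_betw \<phi> (carrier ?Q) (carrier A)"
    using ring by (auto simp: ring_iso_def)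
  have zero: "\<phi> \<zero>\<^bsub>?Q\<^esub> = \<zero>\<^bsub>A\<^esub>"
    using ring_hom_zero[OF hom] Q.A.ring_axioms A.ring_axioms by blast
  have "presentation A (\<lambda>p. \<phi> (?q p)) J"
  proof (rule presentation.intro)
    show "range (\<lambda>p. \<phi> (?q p)) = carrier A"
      using bij Q.surj by (metis bij_betw_imp_surj_on image_image)
    show "\<phi> (?q (p + q)) = \<phi> (?q p) \<oplus>\<^bsub>A\<^esub> \<phi> (?q q)" for p q
      by (simp add: Q.hom_add ring_hom_add[OF hom])
    show "\<phi> (?q (p * q)) = \<phi> (?q p) \<otimes>\<^bsub>A\<^esub> \<phi> (?q q)" for p q
      by (simp add: Q.hom_mult ring_hom_mult[OF hom])
    show "\<phi> (?q 1) = \<one>\<^bsub>A\<^esub>" by (simp add: Q.hom_one ring_hom_one[OF hom])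
    show "\<phi> (?q (cst c * p)) = c \<odot>\<^bsub>A\<^esub> \<phi> (?q p)" for c p
      by (simp add: Q.hom_scale module_hom_smult[OF lin])
    show "\<phi> (?q p) = \<zero>\<^bsub>A\<^esub> \<longleftrightarrow> p \<in> J" for p
      using bij_betw_imp_inj_on[OF bij] Q.closed[of p]
      by (metis Q.A.zero_closed Q.kernel inj_onD zero)
  qed (rule A)
  then show ?thesis by (rule that)
qed

lemma (in presentation) alg_isomorphic: "alg_isomorphic (quot_algebra poly_algebra J) A"
proof -
  let ?Q = "quot_algebra poly_algebra J" and ?q = "\<lambda>p. J +>\<^bsub>poly_algebra\<^esub> p"
  interpret Q: presentation ?Q ?q J
    by (intro presentation_quotient poly_ideal_axioms)
  define \<phi> where "\<phi> X = h (SOME p. X = ?q p)" for X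
  have \<phi>: "\<phi> (?q p) = h p" for p
    unfolding \<phi>_def by (rule someI2[of _ p]) (auto simp: eq_iff Q.eq_iff intro: diff_mem_swap)
  have ex: "\<exists>p. X = ?q p" if "X \<in> carrier ?Q" for X
    using that Q.surj by auto
  have "\<phi> \<in> Ring.ring_hom ?Q A"
  proof (rule ring_hom_memI)
    show "\<phi> X \<in> carrier A" if "X \<in> carrier ?Q" for X
      using ex[OF that] by (auto simp: \<phi>)
    show "\<phi> (X \<otimes>\<^bsub>?Q\<^esub> Y) = \<phi> X \<otimes>\<^bsub>A\<^esub> \<phi> Y" if "X \<in> carrier ?Q" "Y \<in> carrier ?Q" for X Y
      using ex[OF that(1)] ex[OF that(2)] by (auto simp: \<phi> hom_mult simp flip: Q.hom_mult)
    show "\<phi> (X \<oplus>\<^bsub>?Q\<^esub> Y) = \<phi> X \<oplus>\<^bsub>A\<^esub> \<phi> Y" if "X \<in> carrier ?Q" "Y \<in> carrier ?Q" for X Y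
      using ex[OF that(1)] ex[OF that(2)] by (auto simp: \<phi> hom_add simp flip: Q.hom_add)
    show "\<phi> \<one>\<^bsub>?Q\<^esub> = \<one>\<^bsub>A\<^esub>" using \<phi>[of 1] by (simp add: hom_one Q.hom_one)
  qed
  moreover have "bij_betw \<phi> (carrier ?Q) (carrier A)"
  proof (rule bij_betw_imageI)
    show "inj_on \<phi> (carrier ?Q)"
    proof (rule inj_onI)
      fix X Y assume "X \<in> carrier ?Q" "Y \<in> carrier ?Q" "\<phi> X = \<phi> Y"
      then show "X = Y" using ex[of X] ex[of Y] by (metis \<phi> eq_iff Q.eq_iff)
    qed
    show "\<phi> ` carrier ?Q = carrier A"
      unfolding Q.surj[symmetric] surj[symmetric] by (simp add: image_image \<phi>)
  qed
  moreover have "\<phi> \<in> LinearCombinations.module_hom class_ring ?Q A"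
    unfolding LinearCombinations.module_hom_def
  proof (intro CollectI conjI allI impI)
    show "\<phi> \<in> carrier ?Q \<rightarrow> carrier A" using ex by (auto simp: \<phi> dest!: ex)
    show "\<phi> (X \<oplus>\<^bsub>?Q\<^esub> Y) = \<phi> X \<oplus>\<^bsub>A\<^esub> \<phi> Y" if "X \<in> carrier ?Q \<and> Y \<in> carrier ?Q" for X Y
      using ex[of X] ex[of Y] that by (auto simp: \<phi> hom_add simp flip: Q.hom_add)
    show "\<phi> (c \<odot>\<^bsub>?Q\<^esub> X) = c \<odot>\<^bsub>A\<^esub> \<phi> X" if "c \<in> carrier class_ring \<and> X \<in> carrier ?Q" for c X
      using ex[of X] that by (auto simp: \<phi> hom_scale simp flip: Q.hom_scale)
  qed
  ultimately show ?thesis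
    unfolding alg_isomorphic_def ring_iso_def by blast
qed

lemma (in presentation) iso_locus: "J \<in> iso_locus A"
  using alg_isomorphic poly_ideal_axioms by (simp add: iso_locus_def ideal_poly_algebra_iff)

section \<open>Charts and coordinates of the Hilbert scheme\<close>

lemma basis_mod_imp_chart:
  fixes J :: "('n, 'k::field) mpol set"
  assumes J: "poly_ideal J" and B: "basis_mod J B xpow"
  shows "J \<in> chart (card B) B"
proof -
  interpret Q: presentation "quot_algebra poly_algebra J" "\<lambda>p. J +>\<^bsub>poly_algebra\<^esub> p" J
    using J by (rule presentation_quotient)
  show ?thesis
    using J Q.basis_image[OF B]
    by (simp add: chart_def hilbert_points_def ideal_poly_algebra_iff residue_class_def[abs_def])
qed

text \<open>Outside \<open>B\<close> the coordinate is the default value of an extensional function. It is the same constant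
for every ideal of the chart, hence polynomial in any parameter.\<close>

lemma coord_eq_coeff_mod:
  fixes J :: "('n, 'k::field) mpol set"
  assumes J: "poly_ideal J" and B: "basis_mod J B xpow"
  shows "coord B J (m, b) = (if b \<in> B then coeff_mod J B xpow (xpow m) b else undefined)"
proof -
  interpret Q: presentation "quot_algebra poly_algebra J" "\<lambda>p. J +>\<^bsub>poly_algebra\<^esub> p" J
    using J by (rule presentation_quotient)
  let ?c = "coeff_mod J B xpow (xpow m)"
  have expand: "residue_class J m = (\<Oplus>\<^bsub>quot_algebra poly_algebra J\<^esub>b\<in>B.
      a b \<odot>\<^bsub>quot_algebra poly_algebra J\<^esub> residue_class J b) \<longleftrightarrow>
      xpow m - (\<Sum>b\<in>B. cst (a b) * xpow b) \<in> J" for a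
    unfolding residue_class_def Q.hom_lincomb[OF basis_modD(1)[OF B], symmetric]
    by (rule Q.eq_iff)
  have "(THE a. a \<in> B \<rightarrow>\<^sub>E UNIV \<and> residue_class J m =
      (\<Oplus>\<^bsub>quot_algebra poly_algebra J\<^esub>b\<in>B. a b \<odot>\<^bsub>quot_algebra poly_algebra J\<^esub> residue_class J b)) =
      restrict ?c B"
    unfolding expand
  proof (rule the_equality)
    have "(\<Sum>b\<in>B. cst (restrict ?c B b) * xpow b) = (\<Sum>b\<in>B. cst (?c b) * xpow b)"
      by (rule sum.cong) auto
    then show "restrict ?c B \<in> B \<rightarrow>\<^sub>E UNIV \<and> xpow m - (\<Sum>b\<in>B. cst (restrict ?c B b) * xpow b) \<in> J"
      using Q.coeff_mod[OF B, of "xpow m"] by simp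
    fix a assume a: "a \<in> B \<rightarrow>\<^sub>E UNIV \<and> xpow m - (\<Sum>b\<in>B. cst (a b) * xpow b) \<in> J"
    show "a = restrict ?c B"
    proof
      fix b show "a b = restrict ?c B b"
        using a Q.coeff_mod_unique[OF B, of "xpow m" a b] by (auto simp: PiE_def extensional_def)
    qed
  qed
  then show ?thesis by (simp add: coord_def)
qed

section \<open>Change of generators\<close>

lemma basis_mod_subst:
  fixes J :: "('n::finite, 'k::field) mpol set"
  assumes "basis_mod J B (mev f)"
  shows "basis_mod {p. subst f p \<in> J} B xpow"
  unfolding basis_mod_def
proof (intro conjI allI impI ballI)
  show "finite B" using assms by (rule basis_modD)
  show "\<exists>c. r - (\<Sum>b\<in>B. cst (c b) * xpow b) \<in> {p. subst f p \<in> J}" for r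
    using basis_modD(2)[OF assms, of "subst f r"] by (simp add: subst_diff subst_sum subst_mult)
  show "c b = 0" if "(\<Sum>b\<in>B. cst (c b) * xpow b) \<in> {p. subst f p \<in> J}" "b \<in> B" for c b
    using that basis_modD(3)[OF assms, of c b] by (simp add: subst_sum subst_mult)
qed

text \<open>If the values of some monomials at \<open>f\<close> generate \<open>R/J\<close>, then so does \<open>f\<close> as an algebra. So the
substitution of \<open>f\<close> gives another presentation of the same algebra.\<close>

lemma presentation_subst:
  fixes J :: "('n::finite, 'k::field) mpol set"
  assumes "presentation A h J" and B: "basis_mod J B (mev f)"
  shows "presentation A (\<lambda>p. h (subst f p)) {p. subst f p \<in> J}"
proof -
  interpret presentation A h J by fact
  show ?thesis
  proof (rule presentation.intro[OF algebra])
    show "range (\<lambda>p. h (subst f p)) = carrier A"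
    proof
      show "carrier A \<subseteq> range (\<lambda>p. h (subst f p))"
      proof
        fix v assume "v \<in> carrier A"
        then obtain r where r: "v = h r" using surj by auto
        obtain c where "r - (\<Sum>b\<in>B. cst (c b) * mev f b) \<in> J"
          using basis_modD(2)[OF B] by blast
        then have "v = h (subst f (\<Sum>b\<in>B. cst (c b) * xpow b))"
          by (simp add: r eq_iff subst_sum subst_mult)
        then show "v \<in> range (\<lambda>p. h (subst f p))" by blast
      qed
    qed auto
      show "h (subst f (cst c * p)) = c \<odot>\<^bsub>A\<^esub> h (subst f p)" for c p
        by (simp only: subst_mult subst_cst hom_scale)
    qed (simp_all add: subst_add subst_mult hom_add hom_mult hom_one kernel)
qed

lemma (in poly_ideal) basis_mod_rescale:
  assumes B: "basis_mod J B g" and a: "\<And>b. b \<in> B \<Longrightarrow> a b \<noteq> 0"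
  shows "basis_mod J B (\<lambda>b. cst (a b) * g b)"
  unfolding basis_mod_def
proof (intro conjI allI impI ballI)
  show "finite B" using B by (rule basis_modD)
  show "\<exists>c. r - (\<Sum>b\<in>B. cst (c b) * (cst (a b) * g b)) \<in> J" for r
  proof -
    obtain c where "r - (\<Sum>b\<in>B. cst (c b) * g b) \<in> J" using basis_modD(2)[OF B] by blast
    moreover have "(\<Sum>b\<in>B. cst (c b) * g b) = (\<Sum>b\<in>B. cst (c b / a b) * (cst (a b) * g b))"
      using a by (intro sum.cong) (auto simp: simp flip: mult.assoc cst_mult)
    ultimately have "r - (\<Sum>b\<in>B. cst (c b / a b) * (cst (a b) * g b)) \<in> J" by simp
    then show ?thesis by (rule exI[of _ "\<lambda>b. c b / a b"])
  qed
  fix c b assume "(\<Sum>b\<in>B. cst (c b) * (cst (a b) * g b)) \<in> J" "b \<in> B"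
  then show "c b = 0"
    using basis_modD(3)[OF B, of "\<lambda>b. c b * a b" b] a[of b] by (simp add: cst_mult mult.assoc)
qed

section \<open>Monomial ideals\<close>

definition mon_span :: "'n mon set \<Rightarrow> ('n, 'k::field) mpol set"
  where "mon_span U = {p. Poly_Mapping.keys p \<subseteq> U}"

lemma xpow_mem_mon_span [simp]: "xpow m \<in> mon_span U \<longleftrightarrow> m \<in> U"
  by (simp add: mon_span_def xpow_def)

lemma poly_ideal_mon_span:
  assumes "\<And>m q. m \<in> U \<Longrightarrow> m + q \<in> U"
  shows "poly_ideal (mon_span U)"
proof
  show "p + q \<in> mon_span U" if "p \<in> mon_span U" "q \<in> mon_span U" for p q
    using that Poly_Mapping.keys_add[of p q] by (auto simp: mon_span_def)
  show "r * p \<in> mon_span U" if "p \<in> mon_span U" for p r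
    unfolding mon_span_def
  proof safe
    fix k assume "k \<in> Poly_Mapping.keys (r * p)"
    then obtain a b where "b \<in> Poly_Mapping.keys p" and k: "k = a + b"
      using keys_mult[of r p] by auto
    then have "b \<in> U" using that by (auto simp: mon_span_def)
    then show "k \<in> U" using assms[of b a] by (simp add: k add.commute)
  qed
qed (simp add: mon_span_def)

lemma mon_span_eq_genideal:
  assumes "poly_ideal (mon_span U :: ('n, 'k::field) mpol set)"
  shows "mon_span U = (genideal poly_algebra (xpow ` U) :: ('n, 'k) mpol set)"
proof
  interpret R: ring "poly_algebra :: ('k, ('n, 'k) mpol) module" by (rule ring_poly_algebra)
  have "ideal (genideal poly_algebra (xpow ` U)) (poly_algebra :: ('k, ('n, 'k) mpol) module)"
    by (rule R.genideal_ideal) simp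
  then interpret G: poly_ideal "genideal poly_algebra (xpow ` U) :: ('n, 'k) mpol set"
    by (simp add: ideal_poly_algebra_iff)
  show "genideal poly_algebra (xpow ` U) \<subseteq> (mon_span U :: ('n, 'k) mpol set)"
    using assms by (intro R.genideal_minimal) (auto simp: ideal_poly_algebra_iff)
  show "mon_span U \<subseteq> (genideal poly_algebra (xpow ` U) :: ('n, 'k) mpol set)"
  proof
    fix p :: "('n, 'k) mpol" assume "p \<in> mon_span U"
    then have "(\<Sum>m\<in>Poly_Mapping.keys p. cst (Poly_Mapping.lookup p m) * xpow m) \<in>
        genideal poly_algebra (xpow ` U)"
      using R.genideal_self[of "xpow ` U"]
      by (intro G.sum_mem G.mult_mem) (auto simp: mon_span_def)
    then show "p \<in> genideal poly_algebra (xpow ` U)" by (simp flip: mpol_as_sum)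
  qed
qed

lemma basis_mod_mon_span:
  assumes fin: "finite B"
  shows "basis_mod (mon_span (- B) :: ('n, 'k::field) mpol set) B xpow"
  unfolding basis_mod_def
proof (intro conjI allI impI ballI)
  have lookup: "Poly_Mapping.lookup (\<Sum>b\<in>B. cst (c b) * xpow b :: ('n, 'k) mpol) m =
      (if m \<in> B then c m else 0)" for c m
    using fin by (simp add: cst_mult_xpow lookup_sum lookup_single when_def sum.delta')
  show "\<exists>c. r - (\<Sum>b\<in>B. cst (c b) * xpow b) \<in> mon_span (- B)" for r :: "('n, 'k) mpol"
    by (rule exI[of _ "Poly_Mapping.lookup r"])
      (auto simp: mon_span_def in_keys_iff lookup_minus lookup)
  show "c b = 0" if "(\<Sum>b\<in>B. cst (c b) * xpow b :: ('n, 'k) mpol) \<in> mon_span (- B)" "b \<in> B" for c b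
  proof -
    have "b \<notin> Poly_Mapping.keys (\<Sum>b\<in>B. cst (c b) * xpow b :: ('n, 'k) mpol)"
      using that by (auto simp: mon_span_def)
    then show ?thesis using lookup[of c b] that(2) by (simp add: in_keys_iff)
  qed
qed (rule fin)

lemma irrelevant_ideal_subset:
  "(irrelevant_ideal :: ('n, 'k::field) mpol set) \<subseteq>
    mon_span {m. \<exists>i m'. m = Poly_Mapping.single i 1 + m'}"
proof -
  interpret R: ring "poly_algebra :: ('k, ('n, 'k) mpol) module" by (rule ring_poly_algebra)
  have "poly_ideal (mon_span {m :: 'n mon. \<exists>i m'. m = Poly_Mapping.single i 1 + m'}
      :: ('n, 'k) mpol set)"
    by (rule poly_ideal_mon_span) (simp, metis add.assoc)
  moreover have "var i \<in> (mon_span {m. \<exists>i m'. m = Poly_Mapping.single i 1 + m'}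
      :: ('n, 'k) mpol set)" for i
    unfolding var_def xpow_mem_mon_span
    by (intro CollectI exI[of _ i] exI[of _ 0]) simp
  ultimately show ?thesis
    unfolding irrelevant_ideal_def
    by (intro R.genideal_minimal) (auto simp: ideal_poly_algebra_iff)
qed

lemma irrelevant_ideal_square_subset:
  "ideal_prod poly_algebra irrelevant_ideal (irrelevant_ideal :: ('n, 'k::field) mpol set) \<subseteq>
    mon_span {m. \<exists>i j m'. m = Poly_Mapping.single i 1 + Poly_Mapping.single j 1 + m'}"
  (is "_ \<subseteq> mon_span ?U")
proof
  interpret U: poly_ideal "mon_span ?U :: ('n, 'k) mpol set"
    by (rule poly_ideal_mon_span) (simp, metis add.assoc)
  fix q :: "('n, 'k) mpol"
  assume "q \<in> ideal_prod poly_algebra irrelevant_ideal irrelevant_ideal"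
  then show "q \<in> mon_span ?U"
  proof induction
    case (prod p q)
    show ?case unfolding mon_span_def
    proof safe
      fix m assume "m \<in> Poly_Mapping.keys (p \<otimes>\<^bsub>poly_algebra\<^esub> q)"
      then obtain a b where "a \<in> Poly_Mapping.keys p" "b \<in> Poly_Mapping.keys q" and m: "m = a + b"
        using keys_mult[of p q] by auto
      moreover from this obtain i a' j b' where "a = Poly_Mapping.single i 1 + a'"
        "b = Poly_Mapping.single j 1 + b'"
        using prod irrelevant_ideal_subset[where 'n = 'n and 'k = 'k] unfolding mon_span_def by blast
      ultimately have "m = Poly_Mapping.single i 1 + Poly_Mapping.single j 1 + (a' + b')"
        by (simp add: ac_simps)
      then show "\<exists>i j m'. m = Poly_Mapping.single i 1 + Poly_Mapping.single j 1 + m'" by blast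
    qed
  next
    case (sum p q)
    then have "p + q \<in> mon_span ?U" by (intro U.add_mem)
    then show ?case by simp
  qed
qed

section \<open>The complement of a minimal monomial basis\<close>

context minimal_monomial_basis
begin

lemma poly_ideal_complement: "poly_ideal (mon_span (- B) :: ('n, 'k) mpol set)"
  by (rule poly_ideal_mon_span) (simp add: complement_closed)

text \<open>The Borel condition is the case of \<open>complement_sheared\<close> in which the heavier monomial is a variable,
and the squat condition is the case of a product of two variables.\<close>

lemma squat_complement:
  assumes w_mono: "\<And>i j. j < i \<Longrightarrow> w i < w j" and w_less_add: "\<And>i j k. w i < w j + w k"
  shows "squat (mon_span (- B) :: ('n, 'k) mpol set)"
proof -
  let ?I = "mon_span (- B) :: ('n, 'k) mpol set"
  interpret Q: presentation "quot_algebra poly_algebra ?I" "\<lambda>p. ?I +>\<^bsub>poly_algebra\<^esub> p" ?I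
    by (intro presentation_quotient poly_ideal_complement)
  have var: "var i * xpow m \<in> ?I \<longleftrightarrow> m + Poly_Mapping.single i 1 \<notin> B" for i m
    by (simp add: var_def add.commute flip: xpow_add)
  have "monomial_ideal ?I"
    unfolding monomial_ideal_def using mon_span_eq_genideal[OF poly_ideal_complement] by blast
  moreover have "zero_dim_ideal ?I"
    unfolding zero_dim_ideal_def using Q.basis_image(3)[OF basis_mod_mon_span[OF finite_B]]
      poly_ideal_complement by (simp add: ideal_poly_algebra_iff)
  moreover have "var j * xpow m \<in> ?I" if "j \<le> i" "var i * xpow m \<in> ?I" for i j m
    using that complement_sheared[of m i "Poly_Mapping.single j 1"] w_mono[of j i]
    unfolding var by (cases "j = i") auto
  moreover have "q * xpow m \<in> ?I" if i: "var i * xpow m \<in> ?I"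
    and q: "q \<in> ideal_prod poly_algebra irrelevant_ideal irrelevant_ideal" for i m q
    unfolding mon_span_def
  proof safe
    fix k assume k: "k \<in> Poly_Mapping.keys (q * xpow m)" "k \<in> B"
    obtain k' where k': "k' \<in> Poly_Mapping.keys q" and k_eq: "k = k' + m"
      using k(1) keys_mult[of q "xpow m"] by (auto simp: xpow_def)
    obtain j l m' where "k' = Poly_Mapping.single j 1 + Poly_Mapping.single l 1 + m'"
      using k' q irrelevant_ideal_square_subset[where 'n = 'n and 'k = 'k]
      unfolding mon_span_def by blast
    then have "k = m + (Poly_Mapping.single j 1 + Poly_Mapping.single l 1) + m'"
      by (simp add: k_eq ac_simps)
    moreover have "m + (Poly_Mapping.single j 1 + Poly_Mapping.single l 1) \<notin> B"
    proof (rule complement_sheared)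
      show "m + Poly_Mapping.single i 1 \<notin> B" using i unfolding var .
      show "w i < wt w (Poly_Mapping.single j 1 + Poly_Mapping.single l 1)"
        unfolding wt_add wt_single by (rule w_less_add)
    qed
    ultimately show False using complement_closed k(2) by blast
  qed
  ultimately show ?thesis unfolding squat_def borel_fixed_def by blast
qed

text \<open>The rescaling of \<open>f\<^sub>i\<close> to \<open>t\<close> to the power \<open>w\<^sub>i\<close> times \<open>f\<^sub>i\<close> gives ideals \<open>K t\<close> in the locus of \<open>A\<close>. On
the chart of \<open>B\<close> their coordinates are those at \<open>t = 1\<close>, with the coordinate at \<open>(m, b)\<close> multiplied by
\<open>t\<close> to the power \<open>wt w m - wt w b\<close>. The exponent is positive whenever \<open>m\<close> lies outside \<open>B\<close> and the
coordinate is nonzero, so at \<open>t = 0\<close> the coordinates are those of the monomial ideal. A polynomial in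
the coordinates that does not vanish at \<open>t = 0\<close> does not vanish for some \<open>t \<noteq> 0\<close>.\<close>

lemma complement_in_closure:
  assumes "presentation A h J"
  shows "mon_span (- B) \<in> hilbert_scheme (card B) closure_of (iso_locus A)"
  unfolding in_closure_of
proof (intro conjI allI impI)
  interpret presentation A h J by fact
  let ?I = "mon_span (- B) :: ('n, 'k) mpol set"
  have chart_I: "?I \<in> chart (card B) B"
    by (intro basis_mod_imp_chart poly_ideal_complement basis_mod_mon_span finite_B)
  then show "?I \<in> topspace (hilbert_scheme (card B))"
    by (simp add: topspace_hilbert_scheme chart_def)
  fix T assume T: "?I \<in> T \<and> openin (hilbert_scheme (card B)) T"
  then obtain p where pI: "poly_eval (coord B ?I) p \<noteq> 0"
    and pT: "\<And>K. K \<in> chart (card B) B \<Longrightarrow> poly_eval (coord B K) p \<noteq> 0 \<Longrightarrow> K \<in> T"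
    using chart_I unfolding openin_hilbert_scheme hilbert_open_def by blast
  \<comment> \<open>the coordinates on the chart as polynomials in \<open>t\<close>; the truncated subtraction is harmless because
    \<open>coef m b\<close> vanishes when \<open>b\<close> is heavier than \<open>m\<close>\<close>
  define X where "X = (\<lambda>(m, b). if b \<in> B then monom (coef m b) (wt w m - wt w b)
      else [:undefined :: 'k:])"
  define P where "P = (\<Sum>\<mu>\<in>Poly_Mapping.keys p. [:Poly_Mapping.lookup p \<mu>:] *
      (\<Prod>v\<in>Poly_Mapping.keys \<mu>. X v ^ Poly_Mapping.lookup \<mu> v))"
  have P: "poly P t = poly_eval (\<lambda>v. poly (X v) t) p" for t
    by (simp add: P_def poly_eval_def poly_sum poly_prod)
  define f' where "f' t = (\<lambda>i. cst (t ^ w i) * f i)" for t :: 'k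
  define K where "K t = {q. subst (f' t) q \<in> J}" for t
  have mev_f': "mev (f' t) = (\<lambda>m. cst (t ^ wt w m) * mev f m)" for t
    by (rule ext) (simp add: f'_def mev_scale)
  have basis_f': "basis_mod J B (mev (f' t))" if "t \<noteq> 0" for t
    unfolding mev_f' using that by (intro basis_mod_rescale[OF basis]) auto
  have basis_K: "basis_mod (K t) B xpow" if "t \<noteq> 0" for t
    unfolding K_def by (intro basis_mod_subst basis_f' that)
  have K: "presentation A (\<lambda>q. h (subst (f' t) q)) (K t)" if "t \<noteq> 0" for t
    unfolding K_def by (rule presentation_subst[OF assms basis_f'[OF that]])
  have ideal_K: "poly_ideal (K t)" if "t \<noteq> 0" for t
  proof -
    interpret K: presentation A "\<lambda>q. h (subst (f' t) q)" "K t" using that by (rule K)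
    show ?thesis by (rule K.poly_ideal_axioms)
  qed
  have coord_K: "coord B (K t) = (\<lambda>v. poly (X v) t)" if t: "t \<noteq> 0" for t
  proof
    fix v :: "'n mon \<times> 'n mon"
    obtain m b where v: "v = (m, b)" by (cases v)
    interpret K: poly_ideal "K t" using t by (rule ideal_K)
    have "(\<Sum>b\<in>B. cst (coef m b * t ^ (wt w m - wt w b)) * (cst (t ^ wt w b) * mev f b)) =
        (\<Sum>b\<in>B. cst (t ^ wt w m) * (cst (coef m b) * mev f b))"
    proof (rule sum.cong)
      fix b assume "b \<in> B"
      then have "coef m b * t ^ (wt w m - wt w b) * t ^ wt w b = t ^ wt w m * coef m b"
        using coef_nonzero_imp_wt_le[of b m]
        by (cases "coef m b = 0") (simp_all flip: power_add)
      then show "cst (coef m b * t ^ (wt w m - wt w b)) * (cst (t ^ wt w b) * mev f b) =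
          cst (t ^ wt w m) * (cst (coef m b) * mev f b)"
        by (simp only: mult.assoc[symmetric] cst_mult[symmetric])
    qed simp
    then have "xpow m - (\<Sum>b\<in>B. cst (coef m b * t ^ (wt w m - wt w b)) * xpow b) \<in> K t"
      using mult_mem[OF coef[of m], of "cst (t ^ wt w m)"]
      by (simp add: K_def subst_diff subst_sum subst_mult mev_f' right_diff_distrib sum_distrib_left)
    from K.coeff_mod_unique[OF basis_K[OF t] this]
    show "coord B (K t) v = poly (X v) t"
      by (simp add: v coord_eq_coeff_mod[OF ideal_K[OF t] basis_K[OF t]] X_def poly_monom)
  qed
  have coord_I: "coord B ?I = (\<lambda>v. poly (X v) 0)"
  proof
    fix v :: "'n mon \<times> 'n mon"
    obtain m b where v: "v = (m, b)" by (cases v)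
    interpret I: poly_ideal ?I by (rule poly_ideal_complement)
    have basis_I: "basis_mod ?I B xpow" by (intro basis_mod_mon_span finite_B)
    have "coeff_mod ?I B xpow (xpow m) b = coef m b * 0 ^ (wt w m - wt w b)" if b: "b \<in> B"
    proof (cases "m \<in> B")
      case True
      then show ?thesis
        using I.coeff_mod_basis[OF basis_I True b] coef_self[OF True b] by simp
    next
      case False
      then show ?thesis
        using I.coeff_mod_zero[OF basis_I _ b, of "xpow m"] coef_nonzero_imp_wt_less[OF False b]
        by (cases "coef m b = 0") simp_all
    qed
    then show "coord B ?I v = poly (X v) 0"
      by (simp add: v coord_eq_coeff_mod[OF poly_ideal_complement basis_I] X_def poly_monom)
  qed
  have "poly P 0 \<noteq> 0" using pI by (simp add: P coord_I)
  then have "P * [:0, 1:] \<noteq> 0" by auto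
  then have "finite {t. poly (P * [:0, 1:]) t = 0}" by (rule poly_roots_finite)
  then obtain t where t: "poly (P * [:0, 1:]) t \<noteq> 0"
    using infinite_UNIV_char_0[where 'a = 'k] ex_new_if_finite by blast
  then have t0: "t \<noteq> 0" by auto
  have "K t \<in> iso_locus A"
    by (rule presentation.iso_locus[OF K[OF t0]])
  moreover have "K t \<in> T"
    using t by (intro pT basis_mod_imp_chart ideal_K basis_K t0) (simp add: coord_K[OF t0] P)
  ultimately show "\<exists>y. y \<in> iso_locus A \<and> y \<in> T" by blast
qed

end

section \<open>Existence of a squat degeneration\<close>

theorem theorem7p10:
  fixes A :: "('k::{alg_closed_field, field_char_0}, 'a) module"
  assumes "Module.algebra class_ring A"
    and "vectorspace.fin_dim class_ring A"
    and "\<exists>I :: ('n::{finite, linorder}, 'k) mpol set.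
      ideal I poly_algebra \<and> alg_isomorphic (quot_algebra poly_algebra I) A"
  shows "\<exists>I :: ('n, 'k) mpol set.
    I \<in> Abstract_Topology.closure_of (hilbert_scheme (vectorspace.dim class_ring A)) (iso_locus A)
    \<and> squat I"
proof -
  obtain J :: "('n, 'k) mpol set" where J: "ideal J poly_algebra"
    "alg_isomorphic (quot_algebra poly_algebra J) A"
    using assms(3) by blast
  obtain h where h: "presentation A h J"
    using alg_isomorphic_imp_presentation[OF assms(1) J] by blast
  interpret presentation A h J by (rule h)
  obtain B0 where B0: "basis_mod J B0 xpow"
    using monomial_basis_exists[OF assms(2)] by blast
  \<comment> \<open>a degree bound leaves only finitely many monomials to be separated by weights\<close>
  obtain D where D: "\<And>b. b \<in> B0 \<Longrightarrow> mdeg b \<le> D"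
    using finite_nat_set_iff_bounded_le[of "mdeg ` B0"] basis_modD(1)[OF B0] by auto
  obtain w :: "'n \<Rightarrow> nat" where w: "inj_on (wt w) {m. mdeg m \<le> D}"
    "\<And>m m'. mdeg m' \<le> D \<Longrightarrow> D < mdeg m \<Longrightarrow> wt w m' < wt w m"
    "\<And>i j. j < i \<Longrightarrow> w i < w j" "\<And>i j k. w i < w j + w k"
    using separating_weights[of D] by blast
  define good where "good B \<longleftrightarrow> (\<forall>b\<in>B. mdeg b \<le> D) \<and> (\<exists>f. basis_mod J B (mev f))"
    for B :: "'n mon set"
  have "mev var = (xpow :: 'n mon \<Rightarrow> ('n, 'k) mpol)" by (rule ext) (rule mev_var)
  then have "good B0" using B0 D unfolding good_def by metis
  from ex_has_least_nat[of good, OF this] obtain B where "good B"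
    and minimal: "\<And>C. good C \<Longrightarrow> sum (wt w) B \<le> sum (wt w) C" by blast
  then obtain f where B: "\<And>b. b \<in> B \<Longrightarrow> mdeg b \<le> D" "basis_mod J B (mev f)"
    unfolding good_def by blast
  have minimal': "sum (wt w) B \<le> sum (wt w) C"
    if "\<And>c. c \<in> C \<Longrightarrow> mdeg c \<le> D" "basis_mod J C (mev f')" for C f'
    using minimal[of C] that unfolding good_def by blast
  interpret minimal_monomial_basis J D w B f
    by unfold_locales (fact w(1), fact w(2), fact B(1), fact B(2), fact minimal')
  have "presentation A (\<lambda>p. h (subst f p)) {p. subst f p \<in> J}"
    using h B(2) by (rule presentation_subst)
  from presentation.basis_image(4)[OF this basis_mod_subst[OF B(2)]]
  have "vectorspace.dim class_ring A = card B" .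
  then show ?thesis
    using complement_in_closure[OF h] squat_complement[OF w(3,4)] by auto
qed

end
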